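(* Let $(X_n)_{n\ge 0}$ be a homogeneous Markov chain with state space $E$, Markov operator $P$ and stationary probability measure $\nu$, and let $(\mathcal B,\|\cdot\|)$ be a Banach space of $\nu$-measurable functions from $E$ to $\mathbb R$ containing the constant function $\mathbf 1$. Suppose that the chain is $\mathcal B$-geometrically ergodic, with $p\ge 1$ an exponent for which $\mathcal B$ is continuously included in $\mathbb L^p(\nu)$, and let $q\in[1,\infty]$ be defined by $\frac1p+\frac1q=1$. Suppose also that there is a constant $M>0$ such that $\|fP^nf\|\le M\|f\|\,\|P^nf\|$ for all $f\in\mathcal B$ and all integers $n\ge 0$. Then there exists a constant $K$ (not depending on $\varphi$ or $n$) such that for all bounded $\varphi\in\mathcal B$ with $\mathbb E_\nu(\varphi)=0$, and all $n\ge1$, writing $\mathrm m_\varphi=\max\{1,\sup_x|\varphi(x)|\}$ and $S_n(\varphi)=\sum_{i=1}^n\varphi(X_i)$, $$ \mathbb E_\nu\left[S_n(\varphi)^4\right]\le K\,\mathrm m_\varphi^3\left[n\|\varphi(X_0)\|_q\log^3(\|\varphi\|+1)+n^2\|\varphi(X_0)\|_q^2\log^2(\|\varphi\|+1)\right]. $$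
   Context: The chain is stationary: $\mathbb E_\nu$ denotes expectation when $X_0$ has distribution $\nu$; for a function $f$ on $E$, $\mathbb E_\nu(f)=\int f\,d\nu$. The Markov operator is $Pf(x)=\mathbb E(f(X_1)\mid X_0=x)$, and it acts on $\mathcal B$. For $r\in[1,\infty]$, $\|\cdot\|_r$ is the $\mathbb L^r(\nu)$ norm, so $\|\varphi(X_0)\|_q=\left(\int|\varphi|^{q}d\nu\right)^{1/q}$ for $q<\infty$, with the essential supremum norm when $q=\infty$. The notation $\|\cdot\|$ without subscript is the norm of $\mathcal B$, and $\log^k(x)=(\log x)^k$. Definition. The Markov chain $(X_n)_{n\ge0}$ is $\mathcal B$-geometrically ergodic (strongly ergodic with respect to $\mathcal B$) if: (a) there exist $\kappa>0$ and $0<\theta<1$ such that for all $f\in\mathcal B$ and all $n$, $\|P^nf-\Pi f\|\le\kappa\theta^n\|f\|$, where $\Pi f=\mathbb E_\nu(f)\mathbf 1$; (b) there exists $p\ge1$ such that $(\mathcal B,\|\cdot\|)$ is continuously included in $(\mathbb L^p(\nu),\|\cdot\|_p)$, i.e. there is $C>0$ with $\|f\|_p\le C\|f\|$ for all $f\in\mathcal B$. *)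

theory Defs
  imports "HOL-Probability.Probability"
begin

text \<open>The exponent \<open>r\<close> ranges over \<open>[1,\<infinity>]\<close> as an extended nonnegative real. \<open>Lp_norm\<close> is only
  meaningful on \<open>Lp_space\<close>: outside it, the conversions to the reals return junk.\<close>

definition Lp_space :: "'a measure \<Rightarrow> ennreal \<Rightarrow> ('a \<Rightarrow> real) set" where
  "Lp_space M r = {f \<in> borel_measurable M.
     if r = \<infinity> then esssup M (\<lambda>x. ereal \<bar>f x\<bar>) < \<infinity>
     else integrable M (\<lambda>x. \<bar>f x\<bar> powr enn2real r)}"

definition Lp_norm :: "'a measure \<Rightarrow> ennreal \<Rightarrow> ('a \<Rightarrow> real) \<Rightarrow> real" where
  "Lp_norm M r f =
     (if r = \<infinity> then real_of_ereal (esssup M (\<lambda>x. ereal \<bar>f x\<bar>))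
      else (LINT x|M. \<bar>f x\<bar> powr enn2real r) powr (1 / enn2real r))"

text \<open>\<open>natural_filtration \<Omega> E X n\<close> is the \<sigma>-algebra generated by \<open>X 0, \<dots>, X n\<close>; \<open>Q\<close> is the
  transition kernel, the same at every time.\<close>

definition natural_filtration ::
  "'w measure \<Rightarrow> 'e measure \<Rightarrow> (nat \<Rightarrow> 'w \<Rightarrow> 'e) \<Rightarrow> nat \<Rightarrow> 'w measure" where
  "natural_filtration \<Omega> E X n =
     sigma (space \<Omega>) (\<Union>i\<le>n. {X i -` A \<inter> space \<Omega> |A. A \<in> sets E})"

definition markov_chain ::
  "'w measure \<Rightarrow> 'e measure \<Rightarrow> ('e \<Rightarrow> 'e measure) \<Rightarrow> (nat \<Rightarrow> 'w \<Rightarrow> 'e) \<Rightarrow> bool" where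
  "markov_chain \<Omega> E Q X \<longleftrightarrow>
     prob_space \<Omega> \<and> Q \<in> measurable E (prob_algebra E) \<and> (\<forall>n. X n \<in> measurable \<Omega> E) \<and>
     (\<forall>n. \<forall>A\<in>sets E. AE \<omega> in \<Omega>.
        real_cond_exp \<Omega> (natural_filtration \<Omega> E X n) (\<lambda>\<omega>'. indicator A (X (Suc n) \<omega>')) \<omega>
          = measure (Q (X n \<omega>)) A)"

definition stationary_distribution :: "'e measure \<Rightarrow> ('e \<Rightarrow> 'e measure) \<Rightarrow> 'e measure \<Rightarrow> bool" where
  "stationary_distribution E Q \<nu> \<longleftrightarrow> \<nu> \<in> space (prob_algebra E) \<and> bind \<nu> Q = \<nu>"

definition markov_operator :: "('e \<Rightarrow> 'e measure) \<Rightarrow> ('e \<Rightarrow> real) \<Rightarrow> 'e \<Rightarrow> real" where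
  "markov_operator Q f x = (LINT y|Q x. f y)"

text \<open>A Banach space of \<open>\<nu>\<close>-measurable functions is given by a set \<open>B\<close> of functions and a norm \<open>N\<close>.
  Definiteness is only required up to \<open>\<nu>\<close>-null sets, so that both spaces of genuine functions
  (where \<open>N f = 0\<close> forces \<open>f = 0\<close> everywhere) and spaces of functions modulo \<open>\<nu>\<close>-a.e. equality
  (with \<open>B\<close> the set of all representatives) are covered.\<close>

locale banach_function_space =
  fixes \<nu> :: "'e measure" and B :: "('e \<Rightarrow> real) set" and N :: "('e \<Rightarrow> real) \<Rightarrow> real"
  assumes measurable: "B \<subseteq> borel_measurable \<nu>"
    and zero_mem: "(\<lambda>x. 0) \<in> B"
    and add_mem: "\<And>f g. f \<in> B \<Longrightarrow> g \<in> B \<Longrightarrow> (\<lambda>x. f x + g x) \<in> B"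
    and scale_mem: "\<And>f c. f \<in> B \<Longrightarrow> (\<lambda>x. c * f x) \<in> B"
    and norm_nonneg: "\<And>f. f \<in> B \<Longrightarrow> 0 \<le> N f"
    and norm_zero_AE: "\<And>f. f \<in> B \<Longrightarrow> N f = 0 \<Longrightarrow> AE x in \<nu>. f x = 0"
    and norm_triangle: "\<And>f g. f \<in> B \<Longrightarrow> g \<in> B \<Longrightarrow> N (\<lambda>x. f x + g x) \<le> N f + N g"
    and norm_scale: "\<And>f c. f \<in> B \<Longrightarrow> N (\<lambda>x. c * f x) = \<bar>c\<bar> * N f"
    and complete: "\<And>u :: nat \<Rightarrow> 'e \<Rightarrow> real. (\<And>n. u n \<in> B) \<Longrightarrow>
      (\<And>e. e > 0 \<Longrightarrow> \<exists>n0. \<forall>m\<ge>n0. \<forall>n\<ge>n0. N (\<lambda>x. u m x - u n x) < e) \<Longrightarrow>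
      \<exists>f\<in>B. (\<lambda>n. N (\<lambda>x. u n x - f x)) \<longlonglongrightarrow> 0"

definition continuously_included ::
  "'e measure \<Rightarrow> ('e \<Rightarrow> real) set \<Rightarrow> (('e \<Rightarrow> real) \<Rightarrow> real) \<Rightarrow> ennreal \<Rightarrow> bool" where
  "continuously_included \<nu> B N p \<longleftrightarrow>
     B \<subseteq> Lp_space \<nu> p \<and> (\<exists>C>0. \<forall>f\<in>B. Lp_norm \<nu> p f \<le> C * N f)"

definition geometrically_ergodic ::
  "('e \<Rightarrow> 'e measure) \<Rightarrow> 'e measure \<Rightarrow> ('e \<Rightarrow> real) set \<Rightarrow> (('e \<Rightarrow> real) \<Rightarrow> real) \<Rightarrow> bool" where
  "geometrically_ergodic Q \<nu> B N \<longleftrightarrow>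
     (\<exists>\<kappa>>0. \<exists>\<theta>. 0 < \<theta> \<and> \<theta> < 1 \<and>
        (\<forall>f\<in>B. \<forall>n. N (\<lambda>x. (markov_operator Q ^^ n) f x - (LINT y|\<nu>. f y)) \<le> \<kappa> * \<theta> ^ n * N f)) \<and>
     (\<exists>p\<ge>1. continuously_included \<nu> B N p)"

end

theory Submission
  imports Defs
begin

text \<open>
  By polarization the bound on squares makes \<open>B\<close> a Banach algebra up to a constant, so comparing
  the moments of \<open>f\<close> with the norms of its powers shows that \<open>B\<close> embeds continuously in the
  essentially bounded functions. Hence Hoelder's inequality is only needed between
  \<open>L\<close>-one and \<open>L\<close>-infinity, and \<open>P ^ k \<phi>\<close> is a.e. bounded by \<open>min m (c \<theta> ^ k N \<phi>)\<close>.

  With \<open>\<delta>\<close> the \<open>L\<close>-one norm of \<open>\<phi>\<close>, the expectation of a product of four values of \<open>\<phi>\<close> along the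
  chain with gaps \<open>a, b, c\<close> is at most \<open>\<delta> u\<^sub>a u\<^sub>b u\<^sub>c + \<delta>\<^sup>2 u\<^sub>a u\<^sub>c\<close>, where
  \<open>u\<^sub>k = min m (A \<rho> ^ k N \<phi>)\<close>: use the spectral gap across the largest of the three gaps; if it is
  the middle one, this leaves a product of two covariances. Summing over ordered quadruples of
  times and using that the sum of the \<open>u\<^sub>k\<close> is of order \<open>m ln (N \<phi> + 1)\<close> gives the estimate.
\<close>

section \<open>Integrals, sums and kernels\<close>

lemma (in prob_space) integrable_real_bounded:
  fixes f :: "'a \<Rightarrow> real"
  assumes "f \<in> borel_measurable M" "\<And>x. x \<in> space M \<Longrightarrow> \<bar>f x\<bar> \<le> c"
  shows "integrable M f"
  using assms by (intro integrable_const_bound[of _ c]) auto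

lemma (in prob_space) abs_integral_le_bound:
  fixes f :: "'a \<Rightarrow> real"
  assumes "\<And>x. x \<in> space M \<Longrightarrow> \<bar>f x\<bar> \<le> c" "0 \<le> c"
  shows "\<bar>LINT x|M. f x\<bar> \<le> c"
proof (cases "integrable M f")
  case True
  have "\<bar>LINT x|M. f x\<bar> \<le> (LINT x|M. \<bar>f x\<bar>)" by (rule integral_abs_bound)
  also have "\<dots> \<le> (LINT x|M. c)"
    using True assms(1) by (intro integral_mono) auto
  finally show ?thesis by (simp add: prob_space)
\<comment> \<open>A non-integrable function has integral 0 by convention, so the bound reduces to
  \<open>0 \<le> c\<close>.\<close>
qed (use assms(2) in \<open>simp add: not_integrable_integral_eq\<close>)

text \<open>Monotone class argument: an identity known for indicators extends to bounded
  \<open>f\<close>. It serves both the invariance of \<open>\<nu>\<close>, with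
  \<open>Y = 1\<close>, and the one-step Markov property, with \<open>Y\<close> a function of the
  past.\<close>

lemma integral_kernel_eqI:
  fixes f :: "'e \<Rightarrow> real" and Y :: "'w \<Rightarrow> real"
  assumes "prob_space M" and K: "K \<in> measurable M (prob_algebra E)"
    and Z[measurable]: "Z \<in> measurable M E"
    and Y[measurable]: "Y \<in> borel_measurable M" and Yb: "\<And>\<omega>. \<omega> \<in> space M \<Longrightarrow> \<bar>Y \<omega>\<bar> \<le> b"
    and eq: "\<And>A. A \<in> sets E \<Longrightarrow>
      (LINT \<omega>|M. Y \<omega> * indicator A (Z \<omega>)) = (LINT \<omega>|M. Y \<omega> * measure (K \<omega>) A)"
    and f: "f \<in> borel_measurable E" and fb: "\<And>x. x \<in> space E \<Longrightarrow> \<bar>f x\<bar> \<le> c"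
  shows "(LINT \<omega>|M. Y \<omega> * f (Z \<omega>)) = (LINT \<omega>|M. Y \<omega> * (LINT x|K \<omega>. f x))"
proof -
  interpret prob_space M by fact
  have K': "prob_space (K \<omega>)" "sets (K \<omega>) = sets E" "space (K \<omega>) = space E" if "\<omega> \<in> space M" for \<omega>
    using measurable_space[OF K that] by (auto simp: space_prob_algebra dest: sets_eq_imp_space_eq)
  have Kmeas[measurable]: "(\<lambda>\<omega>. LINT x|K \<omega>. g x) \<in> borel_measurable M"
    if "g \<in> borel_measurable E" for g :: "'e \<Rightarrow> real"
    by (rule measurable_compose[OF measurable_prob_algebraD[OF K]
          integral_measurable_subprob_algebra[OF that]])
  have Zsp: "Z \<omega> \<in> space E" if "\<omega> \<in> space M" for \<omega>
    using measurable_space[OF Z that] .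
  have b0: "0 \<le> b" using Yb not_empty by fastforce
  have int1: "integrable M (\<lambda>\<omega>. Y \<omega> * g (Z \<omega>))"
    if "g \<in> borel_measurable E" "\<And>x. x \<in> space E \<Longrightarrow> \<bar>g x\<bar> \<le> d" for g :: "'e \<Rightarrow> real" and d
    using that Zsp Yb b0
    by (intro integrable_real_bounded[where c="b * d"]) (auto simp: abs_mult intro!: mult_mono)
  have Kint: "integrable (K \<omega>) g" "\<bar>LINT x|K \<omega>. g x\<bar> \<le> d"
    if "\<omega> \<in> space M" "g \<in> borel_measurable E" "\<And>x. x \<in> space E \<Longrightarrow> \<bar>g x\<bar> \<le> d" "0 \<le> d" for g :: "'e \<Rightarrow> real" and d \<omega>
  proof -
    interpret k: prob_space "K \<omega>" using K' that by auto
    show "integrable (K \<omega>) g" "\<bar>LINT x|K \<omega>. g x\<bar> \<le> d"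
      using that K'[OF that(1)] by (auto intro!: k.integrable_real_bounded[where c=d] k.abs_integral_le_bound
         simp: measurable_cong_sets[OF K'(2)[OF that(1)] refl])
  qed
  have int2: "integrable M (\<lambda>\<omega>. Y \<omega> * (LINT x|K \<omega>. g x))"
    if "g \<in> borel_measurable E" "\<And>x. x \<in> space E \<Longrightarrow> \<bar>g x\<bar> \<le> d" "0 \<le> d" for g :: "'e \<Rightarrow> real" and d
    using that Yb b0 Kint(2)[OF _ that]
    by (intro integrable_real_bounded[where c="b * d"]) (auto simp: abs_mult intro!: mult_mono Kmeas)
  \<comment> \<open>The induction rule builds nonnegative functions from indicators. The bound
    \<open>d\<close> is arbitrary in the induction because undoing a scaling changes it.\<close>
  have nonneg: "(LINT \<omega>|M. Y \<omega> * g (Z \<omega>)) = (LINT \<omega>|M. Y \<omega> * (LINT x|K \<omega>. g x))"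
    if g: "g \<in> borel_measurable E" "\<And>x. 0 \<le> g x" and "\<And>x. x \<in> space E \<Longrightarrow> g x \<le> d" for g :: "'e \<Rightarrow> real" and d
    using g that(3)
  proof (induction arbitrary: d rule: borel_measurable_induct_real)
    case (set A)
    have "(LINT \<omega>|M. Y \<omega> * (LINT x|K \<omega>. indicator A x)) = (LINT \<omega>|M. Y \<omega> * measure (K \<omega>) A)"
      using set(1) K' by (intro Bochner_Integration.integral_cong) (auto simp: Int_absorb2 sets.sets_into_space)
    then show ?case using eq[OF set(1)] by simp
  next
    case (mult u a)
    show ?case
    proof (cases "a = 0")
      case False
      with mult have "a > 0" by auto
      have "u x \<le> d / a" if "x \<in> space E" for x
        using mult.prems[OF that] \<open>a > 0\<close> by (simp add: field_simps)
      from mult.IH[OF this] show ?thesis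
        by (simp add: mult.left_commute[of _ a])
    qed simp
  next
    case (add u v)
    have b: "u x \<le> d" "v x \<le> d" if "x \<in> space E" for x
      using add.prems[OF that] add.hyps(2)[of x] add.hyps(4)[of x] by linarith+
    have d0: "0 \<le> d" using b(1) add.hyps(2) Zsp not_empty order_trans by blast
    have bb: "\<bar>u x\<bar> \<le> d" "\<bar>v x\<bar> \<le> d" if "x \<in> space E" for x
      using b[OF that] add.hyps(2)[of x] add.hyps(4)[of x] by auto
    have "(LINT \<omega>|M. Y \<omega> * (v (Z \<omega>) + u (Z \<omega>)))
        = (LINT \<omega>|M. Y \<omega> * v (Z \<omega>)) + (LINT \<omega>|M. Y \<omega> * u (Z \<omega>))"
      using int1[OF add.hyps(1) bb(1)] int1[OF add.hyps(3) bb(2)] by (simp add: distrib_left)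
    also have "\<dots> = (LINT \<omega>|M. Y \<omega> * (LINT x|K \<omega>. v x)) + (LINT \<omega>|M. Y \<omega> * (LINT x|K \<omega>. u x))"
      using add.IH(1)[OF b(1)] add.IH(2)[OF b(2)] by simp
    also have "\<dots> = (LINT \<omega>|M. Y \<omega> * (LINT x|K \<omega>. v x) + Y \<omega> * (LINT x|K \<omega>. u x))"
      using int2[OF add.hyps(1) bb(1) d0] int2[OF add.hyps(3) bb(2) d0] by simp
    also have "\<dots> = (LINT \<omega>|M. Y \<omega> * (LINT x|K \<omega>. v x + u x))"
      using Kint(1)[OF _ add.hyps(1) bb(1) d0] Kint(1)[OF _ add.hyps(3) bb(2) d0]
      by (intro Bochner_Integration.integral_cong) (auto simp: distrib_left)
    finally show ?case .
  next
    case (seq U)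
    have Ub: "U i x \<le> d" if "x \<in> space E" for i x
    proof -
      have "incseq (\<lambda>i. U i x)" using seq.hyps(3) by (auto simp: incseq_def le_fun_def)
      then have "U i x \<le> g x" by (rule incseq_le[OF _ seq.hyps(4)[OF that]])
      also have "\<dots> \<le> d" by (rule seq.prems[OF that])
      finally show ?thesis .
    qed
    have d0: "0 \<le> d" using Ub seq.hyps(2) Zsp not_empty order_trans by blast
    have Ubb: "\<bar>U i x\<bar> \<le> d" if "x \<in> space E" for i x
      using Ub[OF that, of i] seq.hyps(2)[of i x] by auto
    note [measurable] = seq.hyps(1) 
    have [measurable]: "g \<in> borel_measurable E"
      by (rule borel_measurable_LIMSEQ_real[OF seq.hyps(4) seq.hyps(1)])
    have "(\<lambda>i. LINT \<omega>|M. Y \<omega> * U i (Z \<omega>)) \<longlonglongrightarrow> (LINT \<omega>|M. Y \<omega> * g (Z \<omega>))"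
      by (rule integral_dominated_convergence[where w="\<lambda>_. b * d"])
        (use Yb Ubb b0 seq.hyps(4) Zsp in \<open>auto simp: abs_mult intro!: AE_I2 mult_mono tendsto_intros\<close>)
    moreover have "(\<lambda>i. LINT \<omega>|M. Y \<omega> * (LINT x|K \<omega>. U i x)) \<longlonglongrightarrow> (LINT \<omega>|M. Y \<omega> * (LINT x|K \<omega>. g x))"
    proof (rule integral_dominated_convergence[where w="\<lambda>_. b * d"])
      show "AE \<omega> in M. (\<lambda>i. Y \<omega> * (LINT x|K \<omega>. U i x)) \<longlonglongrightarrow> Y \<omega> * (LINT x|K \<omega>. g x)"
      proof (intro AE_I2 tendsto_intros)
        fix \<omega> assume \<omega>: "\<omega> \<in> space M"
        interpret k: prob_space "K \<omega>" using K' \<omega> by auto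
        show "(\<lambda>i. LINT x|K \<omega>. U i x) \<longlonglongrightarrow> (LINT x|K \<omega>. g x)"
          by (rule integral_dominated_convergence[where w="\<lambda>_. d"])
            (use Ubb seq.hyps(4) K'[OF \<omega>] in \<open>auto simp: measurable_cong_sets[OF K'(2)[OF \<omega>] refl]\<close>)
      qed
      show "AE \<omega> in M. norm (Y \<omega> * (LINT x|K \<omega>. U i x)) \<le> b * d" for i
        using Yb Kint(2)[OF _ seq.hyps(1) Ubb d0] b0 by (auto simp: abs_mult intro!: mult_mono)
    qed auto
    ultimately show ?case
      using seq.IH[OF Ub] LIMSEQ_unique by (simp add: LIMSEQ_unique)
  qed
  have c0: "0 \<le> c" using fb Zsp not_empty by fastforce
  \<comment> \<open>Shifting by \<open>c\<close> makes \<open>f\<close> nonnegative on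
    \<open>space E\<close>, and the \<open>max\<close> makes \<open>g\<close> nonnegative
    everywhere, as \<open>nonneg\<close> requires. The shift is undone below because each
    \<open>K \<omega>\<close> has mass 1.\<close>
  define g where "g x = max 0 (f x + c)" for x
  have gm: "g \<in> borel_measurable E" unfolding g_def using f by measurable
  have gf: "g x = f x + c" if "x \<in> space E" for x
    using fb[OF that] by (auto simp: g_def)
  have gb: "\<bar>g x\<bar> \<le> 2 * c" if "x \<in> space E" for x
    using fb[OF that] gf[OF that] by auto
  have Yi: "integrable M Y" by (rule integrable_real_bounded[OF Y Yb])
  have "(LINT \<omega>|M. Y \<omega> * f (Z \<omega>)) = (LINT \<omega>|M. Y \<omega> * g (Z \<omega>) - c * Y \<omega>)"
    by (intro Bochner_Integration.integral_cong) (auto simp: gf Zsp algebra_simps)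
  also have "\<dots> = (LINT \<omega>|M. Y \<omega> * g (Z \<omega>)) - c * (LINT \<omega>|M. Y \<omega>)"
    using int1[OF gm gb] Yi by simp
  also have "(LINT \<omega>|M. Y \<omega> * g (Z \<omega>)) = (LINT \<omega>|M. Y \<omega> * (LINT x|K \<omega>. g x))"
    by (rule nonneg[OF gm, of "2 * c"]) (use gb in \<open>auto simp: g_def\<close>)
  also have "\<dots> - c * (LINT \<omega>|M. Y \<omega>) = (LINT \<omega>|M. Y \<omega> * (LINT x|K \<omega>. g x) - c * Y \<omega>)"
    using int2[OF gm gb] Yi c0 by simp
  also have "\<dots> = (LINT \<omega>|M. Y \<omega> * (LINT x|K \<omega>. f x))"
  proof (intro Bochner_Integration.integral_cong refl)
    fix \<omega> assume \<omega>: "\<omega> \<in> space M"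
    interpret k: prob_space "K \<omega>" using K' \<omega> by auto
    have "(LINT x|K \<omega>. g x) = (LINT x|K \<omega>. f x + c)"
      using K'[OF \<omega>] by (intro Bochner_Integration.integral_cong) (auto simp: gf)
    also have "\<dots> = (LINT x|K \<omega>. f x) + c"
      using Kint(1)[OF \<omega> f fb c0] by (simp add: k.prob_space)
    finally show "Y \<omega> * (LINT x|K \<omega>. g x) - c * Y \<omega> = Y \<omega> * (LINT x|K \<omega>. f x)"
      by (simp add: algebra_simps)
  qed
  finally show ?thesis .
qed

text \<open>Since \<open>min 1 x \<le> 2 x / (1 + x)\<close>, each term is dominated by an increment of the telescoping
  sequence \<open>ln (1 + \<rho> ^ k N)\<close>; this covers small and large \<open>N\<close> at once.\<close>

lemma sum_min_geometric_le:
  fixes C \<rho> N m :: real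
  assumes "0 < \<rho>" "\<rho> < 1" "0 \<le> C" "0 \<le> N" "1 \<le> m"
  shows "(\<Sum>k<n. min m (C * \<rho> ^ k * N)) \<le> 2 * (C + 1) / (1 - \<rho>) * m * ln (N + 1)"
proof -
  define a where "a k = ln (1 + \<rho> ^ k * N)" for k
  have step: "min m (C * \<rho> ^ k * N) \<le> 2 * (C + 1) / (1 - \<rho>) * m * (a k - a (Suc k))" for k
  proof -
    define x where "x = \<rho> ^ k * N"
    have x: "0 \<le> x" using assms by (simp add: x_def)
    \<comment> \<open>The inequality \<open>ln y \<le> y - 1\<close> at the ratio of consecutive
      arguments bounds the decrease of \<open>a\<close> from below by a multiple of
      \<open>x / (1 + x)\<close>.\<close>
    have "ln ((1 + \<rho> * x) / (1 + x)) \<le> (1 + \<rho> * x) / (1 + x) - 1"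
      using x assms by (intro ln_le_minus_one) (auto intro!: divide_pos_pos add_pos_nonneg)
    moreover have "ln ((1 + \<rho> * x) / (1 + x)) = a (Suc k) - a k"
    proof -
      have "0 < 1 + \<rho> * x" "0 < 1 + x" using x assms by (auto intro!: add_pos_nonneg)
      then show ?thesis by (simp add: ln_div a_def x_def mult.assoc)
    qed
    moreover have "(1 + \<rho> * x) / (1 + x) - 1 = - ((1 - \<rho>) * (x / (1 + x)))"
      using x by (simp add: field_simps)
    ultimately have 1: "(1 - \<rho>) * (x / (1 + x)) \<le> a k - a (Suc k)" by linarith
    \<comment> \<open>Since \<open>m \<ge> 1\<close>, the factor \<open>m * (C + 1)\<close>
      dominates both \<open>m\<close> and \<open>C\<close>, one for each branch of the
      minimum.\<close>
    have "min m (C * x) \<le> m * (C + 1) * min 1 x"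
    proof (cases "x \<le> 1")
      case True
      have "C * x \<le> (C + 1) * x" using x by (simp add: algebra_simps)
      also have "\<dots> \<le> m * ((C + 1) * x)" using assms x mult_right_mono[of 1 m "(C + 1) * x"] by simp
      finally show ?thesis using True by (simp add: min_def mult.assoc)
    next
      case False
      have "m \<le> m * (C + 1)" using assms by simp
      then show ?thesis using False by (simp add: min_def)
    qed
    also have "min 1 x \<le> 2 * (x / (1 + x))"
      using x by (cases "x \<le> 1") (auto simp: field_simps min_def intro!: mult_left_le)
    also have "x / (1 + x) \<le> (a k - a (Suc k)) / (1 - \<rho>)"
      using 1 assms by (simp add: field_simps)
    finally have "min m (C * x) \<le> m * (C + 1) * (2 * ((a k - a (Suc k)) / (1 - \<rho>)))"
      using assms by (simp add: mult_left_mono)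
    moreover have "m * (C + 1) * (2 * (d / r)) = 2 * (C + 1) / r * m * d" for d r :: real
      by simp
    ultimately show ?thesis unfolding x_def mult.assoc by metis
  qed
  have "(\<Sum>k<n. min m (C * \<rho> ^ k * N)) \<le> (\<Sum>k<n. 2 * (C + 1) / (1 - \<rho>) * m * (a k - a (Suc k)))"
    by (rule sum_mono) (rule step)
  also have "\<dots> = 2 * (C + 1) / (1 - \<rho>) * m * (a 0 - a n)"
    by (simp only: sum_lessThan_telescope' flip: sum_distrib_left)
  also have "\<dots> \<le> 2 * (C + 1) / (1 - \<rho>) * m * ln (N + 1)"
    using assms by (intro mult_left_mono) (auto simp: a_def add.commute)
  finally show ?thesis .
qed

text \<open>Insertion sort on the four indices: \<open>24 = 2 * 3 * 4\<close>, each factor counting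
  the positions at which the next index can enter the sorted tail. Adjacent transpositions generate
  all permutations; ties are counted repeatedly, hence an inequality, valid for nonnegative
  \<open>g\<close>.\<close>

lemma sum4_le_sum_sorted:
  fixes g :: "'i::linorder \<Rightarrow> 'i \<Rightarrow> 'i \<Rightarrow> 'i \<Rightarrow> real"
  assumes fin: "finite I" and nonneg: "\<And>i j k l. 0 \<le> g i j k l"
    and s1: "\<And>i j k l. g i j k l = g j i k l"
    and s2: "\<And>i j k l. g i j k l = g i k j l"
    and s3: "\<And>i j k l. g i j k l = g i j l k"
  shows "(\<Sum>i\<in>I. \<Sum>j\<in>I. \<Sum>k\<in>I. \<Sum>l\<in>I. g i j k l)
    \<le> 24 * (\<Sum>i\<in>I. \<Sum>j\<in>I. \<Sum>k\<in>I. \<Sum>l\<in>I. if i \<le> j \<and> j \<le> k \<and> k \<le> l then g i j k l else 0)"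
proof -
  let ?T = "I \<times> I \<times> I \<times> I"
  define S where "S h = (\<Sum>(i,j,k,l)\<in>?T. h i j k l)" for h :: "'i \<Rightarrow> 'i \<Rightarrow> 'i \<Rightarrow> 'i \<Rightarrow> real"
  have S: "S h = (\<Sum>i\<in>I. \<Sum>j\<in>I. \<Sum>k\<in>I. \<Sum>l\<in>I. h i j k l)" for h
    by (simp add: S_def sum.cartesian_product)
  have sw1: "S (\<lambda>i j k l. h j i k l) = S h" for h
    unfolding S_def
    by (rule sum.reindex_bij_witness[of _ "\<lambda>(i,j,k,l). (j,i,k,l)" "\<lambda>(i,j,k,l). (j,i,k,l)"]) auto
  have sw2: "S (\<lambda>i j k l. h i k j l) = S h" for h
    unfolding S_def
    by (rule sum.reindex_bij_witness[of _ "\<lambda>(i,j,k,l). (i,k,j,l)" "\<lambda>(i,j,k,l). (i,k,j,l)"]) auto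
  have sw3: "S (\<lambda>i j k l. h i j l k) = S h" for h
    unfolding S_def
    by (rule sum.reindex_bij_witness[of _ "\<lambda>(i,j,k,l). (i,j,l,k)" "\<lambda>(i,j,k,l). (i,j,l,k)"]) auto
  have mono: "S h \<le> S h'" if "\<And>i j k l. h i j k l \<le> h' i j k l" for h h'
    unfolding S_def using that by (auto intro!: sum_mono)
  have add: "S (\<lambda>i j k l. h i j k l + h' i j k l) = S h + S h'" for h h'
    unfolding S_def by (simp add: sum.distrib case_prod_beta')
  define a where "a i j k l = (if k \<le> l then g i j k l else 0)" for i j k l
  define b where "b i j k l = (if j \<le> k \<and> k \<le> l then g i j k l else 0)" for i j k l
  define c where "c i j k l = (if i \<le> j \<and> j \<le> k \<and> k \<le> l then g i j k l else 0)" for i j k l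
  have "S g \<le> S (\<lambda>i j k l. a i j k l + a i j l k)"
    by (rule mono) (use nonneg s3 in \<open>auto simp: a_def\<close>)
  also have "\<dots> = 2 * S a" unfolding add sw3[of a] by simp
  also have "S a \<le> S (\<lambda>i j k l. b i j k l + b i k j l + b i k l j)"
  proof (rule mono)
    fix i j k l
    have "g i j k l = g i k j l" "g i k j l = g i k l j" by (rule s2, rule s3)
    then show "a i j k l \<le> b i j k l + b i k j l + b i k l j"
      using nonneg[of i j k l] by (auto simp: a_def b_def)
  qed
  \<comment> \<open>Permuting the arguments of a summand leaves the full sum unchanged, so each
    insertion position contributes \<open>S b\<close>.\<close>
  also have "\<dots> = 3 * S b"
    unfolding add sw2[of b] sw2[of "\<lambda>i j k l. b i j l k"] sw3[of b] by simp
  also have "S b \<le> S (\<lambda>i j k l. c i j k l + c j i k l + c j k i l + c j k l i)"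
  proof (rule mono)
    fix i j k l
    have "g i j k l = g j i k l" "g j i k l = g j k i l" "g j k i l = g j k l i" by (rule s1, rule s2, rule s3)
    note eq = this
    have c0: "0 \<le> c i' j' k' l'" for i' j' k' l'
      by (simp add: c_def nonneg)
    note c0s = c0[of i j k l] c0[of j i k l] c0[of j k i l] c0[of j k l i]
    show "b i j k l \<le> c i j k l + c j i k l + c j k i l + c j k l i"
    proof (cases "j \<le> k \<and> k \<le> l")
      case True
      consider "i \<le> j" | "j \<le> i" "i \<le> k" | "k \<le> i" "i \<le> l" | "l \<le> i" by force
      then show ?thesis
      proof cases
        case 1
        then have "c i j k l = g i j k l" using True by (simp add: c_def)
        then show ?thesis using True c0s by (simp add: b_def)
      next
        case 2
        then have "c j i k l = g i j k l" unfolding eq(1) using True by (simp add: c_def)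
        then show ?thesis using True c0s by (simp add: b_def)
      next
        case 3
        then have "c j k i l = g i j k l" unfolding eq(1,2) using True by (simp add: c_def)
        then show ?thesis using True c0s by (simp add: b_def)
      next
        case 4
        then have "c j k l i = g i j k l" unfolding eq using True by (simp add: c_def)
        then show ?thesis using True c0s by (simp add: b_def)
      qed
    next
      case False
      then have "b i j k l = 0" by (auto simp: b_def)
      then show ?thesis using c0s by simp
    qed
  qed
  also have "\<dots> = 4 * S c"
    unfolding add sw1[of c] sw1[of "\<lambda>i j k l. c i k j l"] sw2[of c]
      sw1[of "\<lambda>i j k l. c i k l j"] sw2[of "\<lambda>i j k l. c i j l k"] sw3[of c]
    by simp
  finally show ?thesis by (simp add: S c_def)
qed

text \<open>If \<open>f\<close> is not integrable, its integral is 0 by convention, and the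
  domination forces \<open>g \<ge> 0\<close> almost everywhere.\<close>

lemma abs_integral_le_integral_AE:
  fixes f g :: "'a \<Rightarrow> real"
  assumes "integrable M g" "AE x in M. \<bar>f x\<bar> \<le> g x"
  shows "\<bar>LINT x|M. f x\<bar> \<le> (LINT x|M. g x)"
proof (cases "integrable M f")
  case True
  have "\<bar>LINT x|M. f x\<bar> \<le> (LINT x|M. \<bar>f x\<bar>)" by (rule integral_abs_bound)
  also have "\<dots> \<le> (LINT x|M. g x)"
    using True assms by (intro integral_mono_AE) auto
  finally show ?thesis .
next
  case False
  have "0 \<le> (LINT x|M. g x)"
    using assms(2) by (intro integral_nonneg_AE) auto
  then show ?thesis using False by (simp add: not_integrable_integral_eq)
qed

text \<open>Jensen's inequality up to the constant 2, which the final constant absorbs.\<close>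

lemma (in prob_space) L1_le_Lp_norm:
  assumes r: "1 \<le> r" and f: "f \<in> Lp_space M r"
  shows "integrable M f" "(LINT x|M. \<bar>f x\<bar>) \<le> 2 * Lp_norm M r f"
proof -
  have [measurable]: "f \<in> borel_measurable M" using f by (simp add: Lp_space_def)
  have "integrable M f \<and> (LINT x|M. \<bar>f x\<bar>) \<le> 2 * Lp_norm M r f"
  proof (cases "r = \<infinity>")
    case True
    let ?e = "esssup M (\<lambda>x. ereal \<bar>f x\<bar>)"
    have fin: "?e < \<infinity>" using f True by (simp add: Lp_space_def)
    have e0: "0 \<le> ?e"
    proof -
      have "esssup M (\<lambda>x. 0 :: ereal) \<le> ?e" by (rule esssup_mono) auto
      then show ?thesis by (simp add: esssup_const emeasure_space_1)
    qed
    then obtain s where s: "?e = ereal s" "0 \<le> s" using fin by (cases ?e) auto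
    have "AE x in M. ereal \<bar>f x\<bar> \<le> ?e" by (rule esssup_AE)
    then have AE: "AE x in M. \<bar>f x\<bar> \<le> s" by (simp add: s)
    have "integrable M f" by (rule integrable_const_bound[of _ s]) (use AE in auto)
    moreover have "\<bar>LINT x|M. \<bar>f x\<bar>\<bar> \<le> (LINT x|M. s)"
      by (rule abs_integral_le_integral_AE) (use AE in auto)
    ultimately show ?thesis using True s by (simp add: Lp_norm_def prob_space)
  next
    case False
    define \<rho> where "\<rho> = enn2real r"
    have \<rho>: "1 \<le> \<rho>" using r False enn2real_mono[of 1 r] by (simp add: \<rho>_def top.not_eq_extremum)
    have int: "integrable M (\<lambda>x. \<bar>f x\<bar> powr \<rho>)" using f False by (simp add: Lp_space_def \<rho>_def)
    \<comment> \<open>Applied to \<open>\<bar>f x\<bar> / t\<close>, with \<open>t\<close> the norm,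
      this integrates to \<open>1 + 1\<close>, which is the source of the constant 2.\<close>
    have le: "y \<le> 1 + y powr \<rho>" if "0 \<le> y" for y :: real
    proof (cases "y \<le> 1")
      case False
      then have "y powr 1 \<le> y powr \<rho>" using \<rho> by (intro powr_mono) auto
      then show ?thesis using False by simp
    qed (use powr_ge_zero[of y \<rho>] in linarith)
    have fint: "integrable M f"
      by (rule Bochner_Integration.integrable_bound[of M "\<lambda>x. 1 + \<bar>f x\<bar> powr \<rho>"]) (use int le in auto)
    define t where "t = (LINT x|M. \<bar>f x\<bar> powr \<rho>) powr (1 / \<rho>)"
    have t: "t = Lp_norm M r f" using False by (simp add: t_def Lp_norm_def \<rho>_def)
    have I0: "0 \<le> (LINT x|M. \<bar>f x\<bar> powr \<rho>)" by simp
    show ?thesis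
    proof (cases "(LINT x|M. \<bar>f x\<bar> powr \<rho>) = 0")
      case True
      then have "AE x in M. \<bar>f x\<bar> powr \<rho> = 0"
        using integral_nonneg_eq_0_iff_AE[OF int] by simp
      then have "(LINT x|M. \<bar>f x\<bar>) = 0" by (intro integral_eq_zero_AE) auto
      moreover have "0 \<le> t" by (simp add: t_def)
      ultimately show ?thesis using fint t by simp
    next
      case False
      then have tp: "0 < t" by (simp add: t_def)
      have tr: "t powr \<rho> = (LINT x|M. \<bar>f x\<bar> powr \<rho>)"
        using False I0 \<rho> by (simp add: t_def powr_powr)
      have "(LINT x|M. \<bar>f x\<bar> / t) \<le> (LINT x|M. 1 + \<bar>f x\<bar> powr \<rho> / t powr \<rho>)"
      proof (rule integral_mono)
        fix x
        show "\<bar>f x\<bar> / t \<le> 1 + \<bar>f x\<bar> powr \<rho> / t powr \<rho>"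
          using le[of "\<bar>f x\<bar> / t"] tp by (simp add: powr_divide)
      qed (use fint int in auto)
      also have "\<dots> = 1 + (LINT x|M. \<bar>f x\<bar> powr \<rho>) / t powr \<rho>" using int by (simp add: prob_space)
      also have "\<dots> = 2" unfolding tr using False by simp
      finally have "(LINT x|M. \<bar>f x\<bar>) \<le> 2 * t" using tp by (simp add: field_simps)
      then show ?thesis using fint t by simp
    qed
  qed
  then show "integrable M f" "(LINT x|M. \<bar>f x\<bar>) \<le> 2 * Lp_norm M r f" by auto
qed

text \<open>Ensures that \<open>Lp_norm\<close> of a bounded observable is meaningful at the
  conjugate exponent, finite or infinite.\<close>

lemma (in prob_space) bounded_in_Lp_space:
  assumes [measurable]: "f \<in> borel_measurable M" and b: "\<And>x. x \<in> space M \<Longrightarrow> \<bar>f x\<bar> \<le> c"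
  shows "f \<in> Lp_space M r"
proof (cases "r = \<infinity>")
  case True
  have "esssup M (\<lambda>x. ereal \<bar>f x\<bar>) \<le> ereal c"
    by (rule esssup_I) (use b in auto)
  then show ?thesis using True by (auto simp: Lp_space_def intro: le_less_trans)
next
  case False
  have "integrable M (\<lambda>x. \<bar>f x\<bar> powr enn2real r)"
    by (rule integrable_real_bounded[of _ "c powr enn2real r"]) (use b in \<open>auto intro!: powr_mono2\<close>)
  then show ?thesis using False by (simp add: Lp_space_def)
qed

section \<open>Stationary Markov chains\<close>

text \<open>The bound holds at every point of \<open>space E\<close> rather than almost everywhere,
  because a kernel \<open>Q x\<close> may charge \<open>\<nu>\<close>-null sets; in this form it
  survives \<open>markov_operator\<close>.\<close>

definition bounded_measurable :: "'e measure \<Rightarrow> real \<Rightarrow> ('e \<Rightarrow> real) set" where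
  "bounded_measurable E c = {f \<in> borel_measurable E. \<forall>x\<in>space E. \<bar>f x\<bar> \<le> c}"

lemma bounded_measurable_mult:
  assumes "f \<in> bounded_measurable E c" "g \<in> bounded_measurable E d"
  shows "(\<lambda>x. f x * g x) \<in> bounded_measurable E (c * d)"
proof -
  have "\<bar>f x * g x\<bar> \<le> c * d" if "x \<in> space E" for x
  proof -
    have "\<bar>f x\<bar> \<le> c" "\<bar>g x\<bar> \<le> d" using assms that by (auto simp: bounded_measurable_def)
    then show ?thesis unfolding abs_mult by (intro mult_mono) auto
  qed
  then show ?thesis using assms by (auto simp: bounded_measurable_def)
qed

locale stationary_markov_chain =
  fixes \<Omega> :: "'w measure" and E :: "'e measure" and Q :: "'e \<Rightarrow> 'e measure"
    and X :: "nat \<Rightarrow> 'w \<Rightarrow> 'e" and \<nu> :: "'e measure"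
  assumes chain: "markov_chain \<Omega> E Q X"
    and stationary: "stationary_distribution E Q \<nu>"
    and initial: "distr \<Omega> E (X 0) = \<nu>"
begin

sublocale prob_space \<Omega>
  using chain by (simp add: markov_chain_def)

lemma Q_measurable [measurable]: "Q \<in> measurable E (prob_algebra E)"
  and X_measurable [measurable]: "X n \<in> measurable \<Omega> E"
  using chain by (auto simp: markov_chain_def)

sublocale stat: prob_space \<nu>
  using stationary by (simp add: stationary_distribution_def space_prob_algebra)

lemma sets_stat [measurable_cong]: "sets \<nu> = sets E" and space_stat: "space \<nu> = space E"
  using stationary
  by (auto simp: stationary_distribution_def space_prob_algebra dest: sets_eq_imp_space_eq)

lemma X_space: "\<omega> \<in> space \<Omega> \<Longrightarrow> X n \<omega> \<in> space E"
  using measurable_space[OF X_measurable] .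

lemma bounded_measurable_nonneg:
  assumes "f \<in> bounded_measurable E c" shows "0 \<le> c"
proof -
  obtain x where "x \<in> space E" using stat.not_empty space_stat by auto
  then have "\<bar>f x\<bar> \<le> c" using assms by (auto simp: bounded_measurable_def)
  then show ?thesis by linarith
qed

lemma bounded_measurable_markov_operator:
  assumes "f \<in> bounded_measurable E c"
  shows "(markov_operator Q ^^ n) f \<in> bounded_measurable E c"
proof (induction n)
  case (Suc n)
  let ?g = "(markov_operator Q ^^ n) f"
  have g: "?g \<in> borel_measurable E" "\<And>x. x \<in> space E \<Longrightarrow> \<bar>?g x\<bar> \<le> c"
    using Suc by (auto simp: bounded_measurable_def)
  have "(\<lambda>x. LINT y|Q x. ?g y) \<in> borel_measurable E"
    by (rule measurable_compose[OF measurable_prob_algebraD[OF Q_measurable]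
          integral_measurable_subprob_algebra[OF g(1)]])
  moreover have "\<bar>LINT y|Q x. ?g y\<bar> \<le> c" if "x \<in> space E" for x
  proof -
    have "Q x \<in> space (prob_algebra E)" using measurable_space[OF Q_measurable that] .
    then have "prob_space (Q x)" "space (Q x) = space E"
      by (auto simp: space_prob_algebra dest: sets_eq_imp_space_eq)
    then show ?thesis
      using g(2) bounded_measurable_nonneg[OF assms] by (intro prob_space.abs_integral_le_bound) auto
  qed
  ultimately show ?case
    by (simp add: bounded_measurable_def markov_operator_def[abs_def])
qed (simp add: assms)

lemma integrable_stat:
  assumes "f \<in> bounded_measurable E c" shows "integrable \<nu> f"
  using assms
  by (intro stat.integrable_real_bounded[of _ c]) (auto simp: bounded_measurable_def space_stat)

text \<open>Invariance \<open>bind \<nu> Q = \<nu>\<close> is the claim for indicators and one step;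
  \<open>integral_kernel_eqI\<close> with \<open>Y = 1\<close> extends it to bounded functions, and
  induction to powers.\<close>

lemma integral_stat_markov_operator:
  assumes "f \<in> bounded_measurable E c"
  shows "(LINT x|\<nu>. (markov_operator Q ^^ n) f x) = (LINT x|\<nu>. f x)"
proof (induction n)
  case (Suc n)
  let ?g = "(markov_operator Q ^^ n) f"
  have g: "?g \<in> borel_measurable E" "\<And>x. x \<in> space E \<Longrightarrow> \<bar>?g x\<bar> \<le> c"
    using bounded_measurable_markov_operator[OF assms, of n] by (auto simp: bounded_measurable_def)
  have Q\<nu>: "Q \<in> measurable \<nu> (prob_algebra E)"
    using Q_measurable by (simp add: measurable_cong_sets[OF sets_stat refl])
  have "(LINT x|\<nu>. 1 * ?g x) = (LINT x|\<nu>. 1 * (LINT y|Q x. ?g y))"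
  proof (rule integral_kernel_eqI[OF stat.prob_space_axioms Q\<nu> _ _ _ _ g])
    fix A assume A: "A \<in> sets E"
    have "measure (bind \<nu> Q) A = (LINT x|\<nu>. measure (Q x) A)"
      by (rule stat.measure_bind[OF measurable_prob_algebraD[OF Q\<nu>] A])
    then show "(LINT x|\<nu>. 1 * indicator A x) = (LINT x|\<nu>. 1 * measure (Q x) A)"
      using stationary A sets.sets_into_space[OF A]
      by (simp add: stationary_distribution_def space_stat Int_absorb2)
  qed (auto simp: measurable_cong_sets[OF sets_stat refl])
  then show ?case using Suc by (simp add: markov_operator_def[abs_def])
qed simp

section \<open>The natural filtration and the Markov property\<close>

lemma space_natural_filtration [simp]: "space (natural_filtration \<Omega> E X n) = space \<Omega>"
  by (simp add: natural_filtration_def space_measure_of_conv)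

lemma sets_natural_filtration:
  "sets (natural_filtration \<Omega> E X n) =
    sigma_sets (space \<Omega>) (\<Union>i\<le>n. {X i -` A \<inter> space \<Omega> |A. A \<in> sets E})"
  unfolding natural_filtration_def by (rule sets_measure_of) auto

lemma subalgebra_natural_filtration: "subalgebra \<Omega> (natural_filtration \<Omega> E X n)"
proof -
  have "sigma_sets (space \<Omega>) (\<Union>i\<le>n. {X i -` A \<inter> space \<Omega> |A. A \<in> sets E}) \<subseteq> sets \<Omega>"
    by (rule sets.sigma_sets_subset) (auto intro!: measurable_sets)
  then show ?thesis
    by (simp add: subalgebra_def sets_natural_filtration)
qed

lemma X_measurable_natural_filtration:
  "i \<le> n \<Longrightarrow> X i \<in> measurable (natural_filtration \<Omega> E X n) E"
  by (rule measurableI) (auto simp: X_space sets_natural_filtration intro!: sigma_sets.Basic)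

lemma measurable_natural_filtration_mono:
  assumes "m \<le> n" "Y \<in> borel_measurable (natural_filtration \<Omega> E X m)"
  shows "Y \<in> borel_measurable (natural_filtration \<Omega> E X n)"
proof (rule measurable_mono[THEN subsetD, OF _ _ _ _ assms(2)])
  show "sets (natural_filtration \<Omega> E X m) \<subseteq> sets (natural_filtration \<Omega> E X n)"
    unfolding sets_natural_filtration
    by (rule sigma_sets_mono') (use assms(1) in \<open>auto intro: order_trans\<close>)
qed auto

text \<open>\<open>markov_chain\<close> prescribes conditional expectations of indicators of the
  next state. Moving the past-measurable \<open>Y\<close> through the conditional expectation gives
  the hypothesis of \<open>integral_kernel_eqI\<close> for the random kernel
  \<open>Q (X n \<omega>)\<close>.\<close>

lemma markov_property_step:
  assumes Y: "Y \<in> borel_measurable (natural_filtration \<Omega> E X n)"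
    and Yb: "\<And>\<omega>. \<omega> \<in> space \<Omega> \<Longrightarrow> \<bar>Y \<omega>\<bar> \<le> b" and f: "f \<in> bounded_measurable E c"
  shows "(LINT \<omega>|\<Omega>. Y \<omega> * f (X (Suc n) \<omega>)) = (LINT \<omega>|\<Omega>. Y \<omega> * markov_operator Q f (X n \<omega>))"
proof -
  interpret F: finite_measure_subalgebra \<Omega> "natural_filtration \<Omega> E X n"
    by unfold_locales (rule subalgebra_natural_filtration)
  have b0: "0 \<le> b" using Yb not_empty by fastforce
  have [measurable]: "Y \<in> borel_measurable \<Omega>"
    by (rule measurable_from_subalg[OF subalgebra_natural_filtration Y])
  have "(LINT \<omega>|\<Omega>. Y \<omega> * f (X (Suc n) \<omega>)) = (LINT \<omega>|\<Omega>. Y \<omega> * (LINT y|Q (X n \<omega>). f y))"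
  proof (rule integral_kernel_eqI[OF prob_space_axioms _ _ _ Yb])
    fix A assume A[measurable]: "A \<in> sets E"
    let ?i = "\<lambda>\<omega>. indicator A (X (Suc n) \<omega>) :: real"
    have int: "integrable \<Omega> (\<lambda>\<omega>. Y \<omega> * ?i \<omega>)"
      by (rule integrable_real_bounded[of _ b]) (use Yb b0 in \<open>auto split: split_indicator\<close>)
    have "AE \<omega> in \<Omega>. real_cond_exp \<Omega> (natural_filtration \<Omega> E X n) ?i \<omega> = measure (Q (X n \<omega>)) A"
      using chain A by (simp add: markov_chain_def)
    then have "(LINT \<omega>|\<Omega>. Y \<omega> * real_cond_exp \<Omega> (natural_filtration \<Omega> E X n) ?i \<omega>)
        = (LINT \<omega>|\<Omega>. Y \<omega> * measure (Q (X n \<omega>)) A)"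
      by (intro integral_cong_AE) (auto intro: measurable_compose[OF X_measurable] measurable_compose[OF Q_measurable])
    moreover have "(LINT \<omega>|\<Omega>. Y \<omega> * real_cond_exp \<Omega> (natural_filtration \<Omega> E X n) ?i \<omega>)
        = (LINT \<omega>|\<Omega>. Y \<omega> * ?i \<omega>)"
      by (rule F.real_cond_exp_intg(2)[OF int Y]) simp
    ultimately show "(LINT \<omega>|\<Omega>. Y \<omega> * ?i \<omega>) = (LINT \<omega>|\<Omega>. Y \<omega> * measure (Q (X n \<omega>)) A)"
      by simp
  qed (use f in \<open>auto simp: bounded_measurable_def\<close>)
  then show ?thesis by (simp add: markov_operator_def)
qed

lemma markov_property:
  assumes Y: "Y \<in> borel_measurable (natural_filtration \<Omega> E X n)"
    and Yb: "\<And>\<omega>. \<omega> \<in> space \<Omega> \<Longrightarrow> \<bar>Y \<omega>\<bar> \<le> b" and f: "f \<in> bounded_measurable E c"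
  shows "(LINT \<omega>|\<Omega>. Y \<omega> * f (X (n + k) \<omega>)) = (LINT \<omega>|\<Omega>. Y \<omega> * (markov_operator Q ^^ k) f (X n \<omega>))"
  using f
proof (induction k arbitrary: f)
  case (Suc k)
  \<comment> \<open>The latest step is integrated out first, so \<open>Y\<close> is viewed as
    measurable for the larger filtration at time \<open>n + k\<close>.\<close>
  have "(LINT \<omega>|\<Omega>. Y \<omega> * f (X (Suc (n + k)) \<omega>)) = (LINT \<omega>|\<Omega>. Y \<omega> * markov_operator Q f (X (n + k) \<omega>))"
    by (rule markov_property_step[OF measurable_natural_filtration_mono[OF _ Y] Yb Suc.prems]) auto
  also have "\<dots> = (LINT \<omega>|\<Omega>. Y \<omega> * (markov_operator Q ^^ k) (markov_operator Q f) (X n \<omega>))"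
    using Suc.IH[of "markov_operator Q f"] bounded_measurable_markov_operator[OF Suc.prems, of 1] by simp
  finally show ?case by (simp only: add_Suc_right funpow_Suc_right o_apply)
qed simp

text \<open>The Markov property with \<open>Y = 1\<close> goes back to time 0, where invariance of
  \<open>\<nu>\<close> under powers of the operator applies.\<close>

lemma distr_X: "distr \<Omega> E (X n) = \<nu>"
proof -
  have "measure (distr \<Omega> E (X n)) A = measure \<nu> A" if A[measurable]: "A \<in> sets E" for A
  proof -
    let ?f = "indicator A :: 'e \<Rightarrow> real"
    have f: "?f \<in> bounded_measurable E 1"
      by (auto simp: bounded_measurable_def split: split_indicator)
    have "measure (distr \<Omega> E (X n)) A = (LINT x|distr \<Omega> E (X n). ?f x)"
      using sets.sets_into_space[OF A] by (simp add: Int_absorb2)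
    also have "\<dots> = (LINT \<omega>|\<Omega>. 1 * ?f (X (0 + n) \<omega>))"
      by (subst integral_distr) auto
    also have "\<dots> = (LINT \<omega>|\<Omega>. 1 * (markov_operator Q ^^ n) ?f (X 0 \<omega>))"
      by (rule markov_property[OF _ _ f, where b=1]) auto
    also have "\<dots> = (LINT x|distr \<Omega> E (X 0). (markov_operator Q ^^ n) ?f x)"
      using bounded_measurable_markov_operator[OF f, of n]
      by (subst integral_distr) (auto simp: bounded_measurable_def)
    also have "\<dots> = (LINT x|\<nu>. ?f x)"
      using integral_stat_markov_operator[OF f, of n] by (simp add: initial)
    also have "\<dots> = measure \<nu> A"
      using sets.sets_into_space[OF A] by (simp add: Int_absorb2 space_stat)
    finally show ?thesis .
  qed
  then show ?thesis
    by (intro measure_eqI)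
      (auto simp: sets_stat stat.emeasure_eq_measure finite_measure.emeasure_eq_measure[OF finite_measure_distr])
qed

lemma integral_X:
  assumes "f \<in> borel_measurable E"
  shows "(LINT \<omega>|\<Omega>. f (X n \<omega>)) = (LINT x|\<nu>. (f x :: real))"
  using integral_distr[OF X_measurable assms, of n] by (simp add: distr_X)

text \<open>Norm bounds on \<open>B\<close> yield statements almost everywhere under
  \<open>\<nu>\<close>; this carries them to each time of the chain.\<close>

lemma AE_X:
  assumes "AE x in \<nu>. R x" shows "AE \<omega> in \<Omega>. R (X n \<omega>)"
  by (rule AE_distrD[OF X_measurable]) (unfold distr_X, fact assms)

lemma integral_X_mult:
  assumes f: "f \<in> bounded_measurable E c" and g: "g \<in> bounded_measurable E d"
  shows "(LINT \<omega>|\<Omega>. f (X i \<omega>) * g (X (i + a) \<omega>)) = (LINT x|\<nu>. f x * (markov_operator Q ^^ a) g x)"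
proof -
  have "(LINT \<omega>|\<Omega>. f (X i \<omega>) * g (X (i + a) \<omega>))
      = (LINT \<omega>|\<Omega>. f (X i \<omega>) * (markov_operator Q ^^ a) g (X i \<omega>))"
    using f by (intro markov_property[OF _ _ g, of _ _ c])
      (auto simp: bounded_measurable_def X_space intro!: measurable_compose[OF X_measurable_natural_filtration])
  also have "\<dots> = (LINT x|\<nu>. f x * (markov_operator Q ^^ a) g x)"
    using bounded_measurable_mult[OF f bounded_measurable_markov_operator[OF g, of a]]
    by (intro integral_X) (simp add: bounded_measurable_def)
  finally show ?thesis .
qed

text \<open>Conditioning successively at the third, second and first time integrates out everything
  later. Each form exposes the operator power of one gap, ready for the spectral gap.\<close>

lemma integral_X_mult4:
  fixes i a b c :: nat and m :: real
  assumes \<phi>: "\<phi> \<in> bounded_measurable E m"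
  defines "T \<equiv> LINT \<omega>|\<Omega>. \<phi> (X i \<omega>) * \<phi> (X (i + a) \<omega>) * \<phi> (X (i + a + b) \<omega>) * \<phi> (X (i + a + b + c) \<omega>)"
    and "P \<equiv> markov_operator Q"
  shows "T = (LINT \<omega>|\<Omega>. \<phi> (X i \<omega>) * \<phi> (X (i + a) \<omega>) * \<phi> (X (i + a + b) \<omega>) * (P ^^ c) \<phi> (X (i + a + b) \<omega>))"
    and "T = (LINT \<omega>|\<Omega>. \<phi> (X i \<omega>) * \<phi> (X (i + a) \<omega>) * (P ^^ b) (\<lambda>x. \<phi> x * (P ^^ c) \<phi> x) (X (i + a) \<omega>))"
    and "T = (LINT x|\<nu>. \<phi> x * (P ^^ a) (\<lambda>x. \<phi> x * (P ^^ b) (\<lambda>x. \<phi> x * (P ^^ c) \<phi> x) x) x)"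
proof -
  note bop = bounded_measurable_markov_operator[folded P_def]
  have Xm: "(\<lambda>\<omega>. \<phi> (X k \<omega>)) \<in> borel_measurable (natural_filtration \<Omega> E X n)" if "k \<le> n" for k n
    using \<phi> measurable_compose[OF X_measurable_natural_filtration[OF that]]
    by (auto simp: bounded_measurable_def)
  have Xb: "\<bar>\<phi> (X k \<omega>)\<bar> \<le> m" if "\<omega> \<in> space \<Omega>" for k \<omega>
    using \<phi> X_space[OF that] by (auto simp: bounded_measurable_def)
  have m0: "0 \<le> m" by (rule bounded_measurable_nonneg[OF \<phi>])
  have Xb2: "\<bar>\<phi> (X k \<omega>) * \<phi> (X l \<omega>)\<bar> \<le> m * m" if "\<omega> \<in> space \<Omega>" for k l \<omega>
    unfolding abs_mult using Xb[OF that] m0 by (intro mult_mono) auto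
  have Xb3: "\<bar>\<phi> (X j \<omega>) * \<phi> (X k \<omega>) * \<phi> (X l \<omega>)\<bar> \<le> m * m * m" if "\<omega> \<in> space \<Omega>" for j k l \<omega>
    unfolding abs_mult[of "_ * _" "\<phi> (X l \<omega>)"] using Xb[OF that] Xb2[OF that] m0 by (intro mult_mono) auto
  note mp = markov_property[folded P_def]
  show 1: "T = (LINT \<omega>|\<Omega>. \<phi> (X i \<omega>) * \<phi> (X (i + a) \<omega>) * \<phi> (X (i + a + b) \<omega>) * (P ^^ c) \<phi> (X (i + a + b) \<omega>))"
    unfolding T_def by (rule mp[OF _ Xb3 \<phi>]) (auto intro!: borel_measurable_times Xm)
  let ?h = "\<lambda>x. \<phi> x * (P ^^ c) \<phi> x"
  have h: "?h \<in> bounded_measurable E (m * m)"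
    by (rule bounded_measurable_mult[OF \<phi> bop[OF \<phi>]])
  have "T = (LINT \<omega>|\<Omega>. \<phi> (X i \<omega>) * \<phi> (X (i + a) \<omega>) * ?h (X (i + a + b) \<omega>))"
    unfolding 1 by (simp add: mult.assoc)
  also have "\<dots> = (LINT \<omega>|\<Omega>. \<phi> (X i \<omega>) * \<phi> (X (i + a) \<omega>) * (P ^^ b) ?h (X (i + a) \<omega>))"
    by (rule mp[OF _ Xb2 h]) (auto intro!: borel_measurable_times Xm)
  finally show 2: "T = \<dots>" .
  have "T = (LINT \<omega>|\<Omega>. \<phi> (X i \<omega>) * (\<lambda>x. \<phi> x * (P ^^ b) ?h x) (X (i + a) \<omega>))"
    unfolding 2 by (simp add: mult.assoc)
  also have "\<dots> = (LINT x|\<nu>. \<phi> x * (P ^^ a) (\<lambda>x. \<phi> x * (P ^^ b) ?h x) x)"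
    unfolding P_def by (rule integral_X_mult[OF \<phi> bounded_measurable_mult[OF \<phi>
      bounded_measurable_markov_operator[OF h[unfolded P_def]]]])
  finally show "T = \<dots>" .
qed

end

section \<open>Banach algebras of functions\<close>

text \<open>\<open>norm_square\<close> is the multiplicative hypothesis at \<open>n = 0\<close>,
  where the iterate is \<open>f\<close> itself; \<open>L1_le\<close> is the continuous inclusion
  weakened to the \<open>L\<close>-one norm.\<close>

locale square_bounded_function_space = banach_function_space \<nu> B N + prob_space \<nu>
  for \<nu> :: "'e measure" and B and N +
  fixes M C :: real
  assumes M_pos: "0 < M"
    and square_mem: "f \<in> B \<Longrightarrow> (\<lambda>x. f x * f x) \<in> B"
    and norm_square: "f \<in> B \<Longrightarrow> N (\<lambda>x. f x * f x) \<le> M * N f * N f"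
    and integrable_mem: "f \<in> B \<Longrightarrow> integrable \<nu> f"
    and C_pos: "0 < C"
    and L1_le: "f \<in> B \<Longrightarrow> (LINT x|\<nu>. \<bar>f x\<bar>) \<le> C * N f"
begin

text \<open>Written with sums and constant multiples of squares, so as to match
  \<open>add_mem\<close>, \<open>scale_mem\<close> and \<open>square_mem\<close>
  syntactically.\<close>

lemma polarization: "u * v = (1/4) * ((u + v) * (u + v)) + (-(1/4)) * ((u + (-1) * v) * (u + (-1) * v))"
  for u v :: real
  by (simp add: algebra_simps)

lemma mult_mem:
  assumes "f \<in> B" "g \<in> B" shows "(\<lambda>x. f x * g x) \<in> B"
  unfolding polarization[of "f _"] by (intro add_mem scale_mem square_mem assms)

text \<open>By homogeneity the unit ball suffices. There the sum and the difference have norm at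
  most 2, and polarization gives \<open>(1/4) * (4 * M) + (1/4) * (4 * M) = 2 * M\<close>.\<close>

lemma norm_mult_le:
  assumes f: "f \<in> B" and g: "g \<in> B"
  shows "N (\<lambda>x. f x * g x) \<le> 2 * M * N f * N g"
proof -
  have unit: "N (\<lambda>x. f x * g x) \<le> 2 * M" if f: "f \<in> B" "N f \<le> 1" and g: "g \<in> B" "N g \<le> 1" for f g
  proof -
    let ?p = "\<lambda>x. f x + g x" and ?m = "\<lambda>x. f x + (-1) * g x"
    have p: "?p \<in> B" and m: "?m \<in> B" by (intro add_mem scale_mem f g)+
    have sq: "N (\<lambda>x. h x * h x) \<le> M * 4" if h: "h \<in> B" "N h \<le> 2" for h
    proof -
      have "N (\<lambda>x. h x * h x) \<le> M * (N h * N h)" using norm_square[OF h(1)] by (simp add: mult.assoc)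
      also have "N h * N h \<le> 2 * 2" using h norm_nonneg by (intro mult_mono) auto
      finally show ?thesis using M_pos by simp
    qed
    have "N ?p \<le> 2" using norm_triangle[OF f(1) g(1)] f g by simp
    moreover have "N ?m \<le> 2"
      using norm_triangle[OF f(1) scale_mem[OF g(1), of "-1"]] norm_scale[OF g(1), of "-1"] f g by simp
    ultimately have "N (\<lambda>x. ?p x * ?p x) \<le> M * 4" "N (\<lambda>x. ?m x * ?m x) \<le> M * 4"
      using sq p m by blast+
    moreover have "N (\<lambda>x. f x * g x)
        \<le> N (\<lambda>x. (1/4) * (?p x * ?p x)) + N (\<lambda>x. (-(1/4)) * (?m x * ?m x))"
      unfolding polarization[of "f _"] by (intro norm_triangle scale_mem square_mem p m)
    moreover have "N (\<lambda>x. (1/4) * (?p x * ?p x)) = (1/4) * N (\<lambda>x. ?p x * ?p x)"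
      "N (\<lambda>x. (-(1/4)) * (?m x * ?m x)) = (1/4) * N (\<lambda>x. ?m x * ?m x)"
      using norm_scale[OF square_mem[OF p], of "1/4"] norm_scale[OF square_mem[OF m], of "-(1/4)"]
      by simp_all
    ultimately show ?thesis by simp
  qed
  \<comment> \<open>\<open>N f\<close> may vanish, so the factors are normalized by
    \<open>N f + e\<close> and \<open>N g + e\<close>, and \<open>e\<close> tends to 0 at the
    end.\<close>
  have eps: "N (\<lambda>x. f x * g x) \<le> 2 * M * (N f + e) * (N g + e)" if e: "0 < e" for e
  proof -
    have pf: "0 < N f + e" and pg: "0 < N g + e" using norm_nonneg[OF f] norm_nonneg[OF g] e by auto
    have rescale: "y * z = (a * b) * ((inverse a * y) * (inverse b * z))" if "0 < a" "0 < b" for a b y z :: real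
      using that by (simp add: field_simps)
    let ?f = "\<lambda>x. inverse (N f + e) * f x" and ?g = "\<lambda>x. inverse (N g + e) * g x"
    have le: "N (\<lambda>x. ?f x * ?g x) \<le> 2 * M"
    proof (intro unit scale_mem f g)
      show "N ?f \<le> 1" unfolding norm_scale[OF f] using pf e by (simp add: field_simps)
      show "N ?g \<le> 1" unfolding norm_scale[OF g] using pg e by (simp add: field_simps)
    qed
    have "N (\<lambda>x. f x * g x) = N (\<lambda>x. ((N f + e) * (N g + e)) * (?f x * ?g x))"
      unfolding rescale[OF pf pg, of "f _"] ..
    also have "\<dots> = ((N f + e) * (N g + e)) * N (\<lambda>x. ?f x * ?g x)"
      using pf pg by (subst norm_scale) (auto intro!: mult_mem scale_mem f g)
    also have "\<dots> \<le> ((N f + e) * (N g + e)) * (2 * M)"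
      using pf pg by (intro mult_left_mono le) auto
    finally show ?thesis by (simp only: mult_ac)
  qed
  have "(\<lambda>n. 2 * M * (N f + 1 / real (Suc n)) * (N g + 1 / real (Suc n)))
      \<longlonglongrightarrow> 2 * M * (N f + 0) * (N g + 0)"
    by (intro tendsto_intros LIMSEQ_Suc lim_const_over_n)
  then have "N (\<lambda>x. f x * g x) \<le> 2 * M * (N f + 0) * (N g + 0)"
    by (rule LIMSEQ_le_const) (use eps in auto)
  then show ?thesis by simp
qed

lemma power_mem:
  assumes f: "f \<in> B"
  shows "(\<lambda>x. f x ^ Suc k) \<in> B" "N (\<lambda>x. f x ^ Suc k) \<le> (2 * M * N f) ^ k * N f"
proof (induction k)
  case (Suc k)
  show "(\<lambda>x. f x ^ Suc (Suc k)) \<in> B"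
    using mult_mem[OF f Suc(1)] by simp
  have "N (\<lambda>x. f x ^ Suc (Suc k)) \<le> 2 * M * N f * N (\<lambda>x. f x ^ Suc k)"
    using norm_mult_le[OF f Suc(1)] by simp
  also have "\<dots> \<le> 2 * M * N f * ((2 * M * N f) ^ k * N f)"
    using M_pos norm_nonneg[OF f] by (intro mult_left_mono Suc(2)) auto
  finally show "N (\<lambda>x. f x ^ Suc (Suc k)) \<le> (2 * M * N f) ^ Suc k * N f" by (simp add: mult.assoc)
qed (use f in auto)

text \<open>Spectral radius argument: the \<open>k\<close>-th moments of \<open>f\<close> are at most of order \<open>(2 M N f) ^ k\<close>.\<close>

lemma AE_abs_le:
  assumes f: "f \<in> B"
  shows "AE x in \<nu>. \<bar>f x\<bar> \<le> 2 * M * N f"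
proof -
  have [measurable]: "f \<in> borel_measurable \<nu>" using f measurable by auto
  define s where "s = 2 * M * N f"
  have s0: "0 \<le> s" using M_pos norm_nonneg[OF f] by (simp add: s_def)
  have ex: "AE x in \<nu>. \<bar>f x\<bar> \<le> t" if t: "s < t" for t
  proof -
    define \<mu> where "\<mu> = prob {x \<in> space \<nu>. t < \<bar>f x\<bar>}"
    have t0: "0 < t" using s0 t by simp
    \<comment> \<open>Markov's inequality for \<open>\<bar>f\<bar> ^ Suc k\<close>, whose integral
      is controlled through the norm of the power.\<close>
    have le: "\<mu> * t \<le> C * N f * (s / t) ^ k" for k
    proof -
      let ?A = "{x \<in> space \<nu>. t < \<bar>f x\<bar>}"
      have i: "integrable \<nu> (\<lambda>x. \<bar>f x ^ Suc k\<bar>)"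
        using integrable_mem[OF power_mem(1)[OF f]] by (rule integrable_abs)
      have "t ^ Suc k * \<mu> = (LINT x|\<nu>. t ^ Suc k * indicator ?A x)"
        by (simp add: \<mu>_def)
      also have "\<dots> \<le> (LINT x|\<nu>. \<bar>f x ^ Suc k\<bar>)"
      proof (rule integral_mono[OF _ i])
        fix x
        show "t ^ Suc k * indicator ?A x \<le> \<bar>f x ^ Suc k\<bar>"
          using t0 power_mono[of t "\<bar>f x\<bar>" "Suc k"]
          by (auto simp: power_abs abs_mult split: split_indicator)
        have "integrable \<nu> (indicator ?A :: _ \<Rightarrow> real)"
          by (rule integrable_real_bounded[of _ 1]) (auto split: split_indicator)
        then show "integrable \<nu> (\<lambda>x. t ^ Suc k * indicator ?A x)" by simp
      qed
      also have "\<dots> \<le> C * N (\<lambda>x. f x ^ Suc k)" by (rule L1_le[OF power_mem(1)[OF f]])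
      also have "\<dots> \<le> C * (s ^ k * N f)"
        using power_mem(2)[OF f] C_pos by (simp add: s_def)
      finally show ?thesis using t0 by (simp add: field_simps power_divide)
    qed
    \<comment> \<open>As \<open>s < t\<close>, the right side vanishes in the limit, so the
      exceedance set is null.\<close>
    have "(\<lambda>k. C * N f * (s / t) ^ k) \<longlonglongrightarrow> C * N f * 0"
      using s0 t by (intro tendsto_intros LIMSEQ_realpow_zero) auto
    then have "\<mu> * t \<le> C * N f * 0" by (rule LIMSEQ_le_const) (use le in auto)
    moreover have "0 \<le> \<mu>" by (simp add: \<mu>_def)
    ultimately have "\<mu> = 0" using t0 by (simp add: mult_le_0_iff)
    then show ?thesis
      by (intro AE_I[of _ _ "{x \<in> space \<nu>. t < \<bar>f x\<bar>}"]) (auto simp: \<mu>_def emeasure_eq_measure)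
  qed
  \<comment> \<open>Countably many thresholds decreasing to \<open>s\<close> give the bound at
    \<open>s\<close> itself.\<close>
  have "AE x in \<nu>. \<forall>n. \<bar>f x\<bar> \<le> s + 1 / real (Suc n)"
    unfolding AE_all_countable by (intro allI ex) simp
  then show ?thesis
  proof eventually_elim
    case (elim x)
    have "(\<lambda>n. s + 1 / real (Suc n)) \<longlonglongrightarrow> s + 0"
      by (intro tendsto_intros LIMSEQ_Suc lim_const_over_n)
    then have "\<bar>f x\<bar> \<le> s + 0" by (rule LIMSEQ_le_const) (use elim in auto)
    then show ?case by (simp add: s_def)
  qed
qed

end

section \<open>Fourth moments under a spectral gap\<close>

locale ergodic_chain =
  stationary_markov_chain \<Omega> E Q X \<nu> + alg: square_bounded_function_space \<nu> B N M C
  for \<Omega> :: "'w measure" and E :: "'e measure" and Q X \<nu> B N M C +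
  fixes \<kappa> \<theta> :: real
  assumes one_mem: "(\<lambda>x. 1) \<in> B"
    and op_mem: "f \<in> B \<Longrightarrow> markov_operator Q f \<in> B"
    and \<kappa>_pos: "0 < \<kappa>" and \<theta>: "0 < \<theta>" "\<theta> < 1"
    and decay: "f \<in> B \<Longrightarrow>
      N (\<lambda>x. (markov_operator Q ^^ n) f x - (LINT y|\<nu>. f y)) \<le> \<kappa> * \<theta> ^ n * N f"
begin

abbreviation "P \<equiv> markov_operator Q"

lemma op_pow_mem: "f \<in> B \<Longrightarrow> (P ^^ n) f \<in> B"
  by (induction n) (auto intro: op_mem)

lemma centered_mem:
  assumes "f \<in> B" shows "(\<lambda>x. f x - c) \<in> B"
  using alg.add_mem[OF assms alg.scale_mem[OF one_mem, of "- c"]] by simp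

text \<open>The centred iterate has small norm by \<open>decay\<close>, and \<open>AE_abs_le\<close>
  turns the norm into an essential bound.\<close>

lemma AE_decay:
  assumes "f \<in> B"
  shows "AE x in \<nu>. \<bar>(P ^^ n) f x - (LINT y|\<nu>. f y)\<bar> \<le> 2 * M * \<kappa> * \<theta> ^ n * N f"
  using alg.AE_abs_le[OF centered_mem[OF op_pow_mem[OF assms]], of n "LINT y|\<nu>. f y"]
proof eventually_elim
  case (elim x)
  have "2 * M * N (\<lambda>x. (P ^^ n) f x - (LINT y|\<nu>. f y)) \<le> 2 * M * (\<kappa> * \<theta> ^ n * N f)"
    using alg.M_pos by (intro mult_left_mono decay assms) auto
  then show ?case using elim by (simp add: mult.assoc)
qed

text \<open>Bounds all powers of the operator on \<open>B\<close>: \<open>\<kappa>\<close> comes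
  from the centred part, \<open>C * N (\<lambda>x. 1)\<close> from the projection onto
  constants.\<close>

definition G :: real where "G = \<kappa> + C * N (\<lambda>x. 1)"

lemma G_nonneg: "0 \<le> G"
  using \<kappa>_pos alg.C_pos alg.norm_nonneg[OF one_mem] by (simp add: G_def)

lemma norm_op_pow_le:
  assumes f: "f \<in> B" shows "N ((P ^^ n) f) \<le> G * N f"
proof -
  let ?c = "LINT y|\<nu>. f y"
  have "N (\<lambda>x. ((P ^^ n) f x - ?c) + ?c * 1) \<le> N (\<lambda>x. (P ^^ n) f x - ?c) + N (\<lambda>x. ?c * 1)"
    by (intro alg.norm_triangle centered_mem op_pow_mem alg.scale_mem one_mem f)
  also have "N (\<lambda>x. (P ^^ n) f x - ?c) \<le> \<kappa> * \<theta> ^ n * N f" by (rule decay[OF f])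
  also have "\<dots> \<le> \<kappa> * 1 * N f"
    using \<theta> \<kappa>_pos alg.norm_nonneg[OF f] by (intro mult_right_mono mult_left_mono power_le_one) auto
  also have "N (\<lambda>x. ?c * 1) = \<bar>?c\<bar> * N (\<lambda>x. 1)" by (rule alg.norm_scale[OF one_mem])
  also have "\<dots> \<le> C * N f * N (\<lambda>x. 1)"
    using order_trans[OF integral_abs_bound alg.L1_le[OF f]] alg.norm_nonneg[OF one_mem]
    by (intro mult_right_mono) auto
  finally show ?thesis by (simp add: G_def algebra_simps)
qed

text \<open>\<open>A \<ge> 1\<close> ensures \<open>A \<le> A ^ 3\<close>, and \<open>\<rho>\<close> is a cube root so that a bound decaying like
  \<open>\<theta>\<close> in the largest of three gaps becomes a product of three bounds decaying like \<open>\<rho>\<close>, one per gap.\<close>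

definition A :: real where "A = 1 + (2 * M) ^ 3 * \<kappa> * (1 + G)\<^sup>2 + 2 * M * \<kappa>"
definition \<rho> :: real where "\<rho> = root 3 \<theta>"

lemma \<rho>: "0 < \<rho>" "\<rho> < 1" "\<rho> ^ 3 = \<theta>"
  using \<theta> by (auto simp: \<rho>_def)

lemma \<rho>_power_cubed: "(\<rho> ^ k) ^ 3 = \<theta> ^ k"
proof -
  have "(\<rho> ^ k) ^ 3 = (\<rho> ^ 3) ^ k" by (simp only: power_mult[symmetric] mult.commute)
  then show ?thesis by (simp only: \<rho>(3))
qed

lemma A_ge: "1 \<le> A" "2 * M * \<kappa> \<le> A" "(2 * M) ^ 3 * \<kappa> * (1 + G)\<^sup>2 \<le> A"
  using alg.M_pos \<kappa>_pos by (auto simp: A_def)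

end

locale centered_observable = ergodic_chain +
  fixes \<phi> and m :: real
  assumes mem: "\<phi> \<in> B" and bounded: "\<phi> \<in> bounded_measurable E m"
    and centered: "(LINT x|\<nu>. \<phi> x) = 0"
begin

definition \<delta> :: real where "\<delta> = (LINT x|\<nu>. \<bar>\<phi> x\<bar>)"

definition u :: "nat \<Rightarrow> real" where "u k = min m (A * \<rho> ^ k * N \<phi>)"

lemma m_nonneg: "0 \<le> m" by (rule bounded_measurable_nonneg[OF bounded])
lemma N_nonneg: "0 \<le> N \<phi>" by (rule alg.norm_nonneg[OF mem])
lemma \<delta>_nonneg: "0 \<le> \<delta>" by (simp add: \<delta>_def)
lemma u_nonneg: "0 \<le> u k" using m_nonneg N_nonneg \<rho> A_ge(1) by (simp add: u_def)

lemma \<phi>_le: "x \<in> space E \<Longrightarrow> \<bar>\<phi> x\<bar> \<le> m"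
  using bounded by (simp add: bounded_measurable_def)

lemma abs_op_le: "x \<in> space E \<Longrightarrow> \<bar>(P ^^ k) \<phi> x\<bar> \<le> m"
  using bounded_measurable_markov_operator[OF bounded] by (simp add: bounded_measurable_def)

lemma u_antimono: "a \<le> b \<Longrightarrow> u b \<le> u a"
proof -
  assume "a \<le> b"
  then have "\<rho> ^ b \<le> \<rho> ^ a" using \<rho> by (intro power_decreasing) auto
  then have "A * \<rho> ^ b * N \<phi> \<le> A * \<rho> ^ a * N \<phi>"
    using A_ge(1) N_nonneg by (intro mult_right_mono mult_left_mono) auto
  then show ?thesis by (auto simp: u_def)
qed

text \<open>The minimum in \<open>u\<close> passes through the cube: the first bound serves when
  \<open>m\<close> is the smaller entry; otherwise the second does, by \<open>A \<le> A ^ 3\<close>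
  and \<open>\<theta> = \<rho> ^ 3\<close>.\<close>

lemma le_u_cubed:
  assumes "y \<le> \<delta> * m ^ 3" "y \<le> \<delta> * (A * \<theta> ^ k * N \<phi> ^ 3)"
  shows "y \<le> \<delta> * u k ^ 3"
proof -
  have "A * 1 \<le> A * A\<^sup>2" using A_ge(1) by (intro mult_left_mono) auto
  then have "A \<le> A ^ 3" by (simp add: power3_eq_cube power2_eq_square)
  then have "A * (\<theta> ^ k * N \<phi> ^ 3) \<le> A ^ 3 * (\<theta> ^ k * N \<phi> ^ 3)"
    using \<theta> N_nonneg by (intro mult_right_mono) auto
  also have "\<dots> = (A * \<rho> ^ k * N \<phi>) ^ 3"
    by (simp add: power_mult_distrib \<rho>_power_cubed)
  finally have "\<delta> * (A * \<theta> ^ k * N \<phi> ^ 3) \<le> \<delta> * (A * \<rho> ^ k * N \<phi>) ^ 3"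
    using \<delta>_nonneg by (intro mult_left_mono) (simp_all add: mult.assoc)
  then show ?thesis using assms by (simp add: u_def min_def)
qed

text \<open>One factor \<open>\<phi>\<close> stays under the integral and contributes its
  \<open>L\<close>-one norm, the same at every time \<open>i\<close> by stationarity; the others are
  bounded by \<open>K\<close>.\<close>

lemma abs_integral_X_le:
  assumes "AE \<omega> in \<Omega>. \<bar>F \<omega>\<bar> \<le> \<bar>\<phi> (X i \<omega>)\<bar> * K"
  shows "\<bar>LINT \<omega>|\<Omega>. F \<omega>\<bar> \<le> \<delta> * K"
proof -
  have "integrable \<Omega> (\<lambda>\<omega>. \<bar>\<phi> (X i \<omega>)\<bar>)"
    using bounded by (intro integrable_real_bounded[of _ m])
      (auto simp: bounded_measurable_def X_space)
  then have "\<bar>LINT \<omega>|\<Omega>. F \<omega>\<bar> \<le> (LINT \<omega>|\<Omega>. \<bar>\<phi> (X i \<omega>)\<bar> * K)"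
    by (intro abs_integral_le_integral_AE assms) auto
  also have "\<dots> = \<delta> * K"
    using bounded integral_X[OF borel_measurable_abs, of \<phi> i] by (simp add: \<delta>_def bounded_measurable_def)
  finally show ?thesis .
qed

lemma abs_integral_stat_le:
  assumes "AE x in \<nu>. \<bar>F x\<bar> \<le> \<bar>\<phi> x\<bar> * K"
  shows "\<bar>LINT x|\<nu>. F x\<bar> \<le> \<delta> * K"
proof -
  have "integrable \<nu> (\<lambda>x. \<bar>\<phi> x\<bar>)"
    using integrable_stat[OF bounded] by simp
  then have "\<bar>LINT x|\<nu>. F x\<bar> \<le> (LINT x|\<nu>. \<bar>\<phi> x\<bar> * K)"
    by (intro abs_integral_le_integral_AE assms) auto
  then show ?thesis by (simp add: \<delta>_def)
qed

lemma abs_covariance_le: "\<bar>LINT x|\<nu>. \<phi> x * (P ^^ k) \<phi> x\<bar> \<le> \<delta> * u k"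
proof (rule abs_integral_stat_le)
  show "AE x in \<nu>. \<bar>\<phi> x * (P ^^ k) \<phi> x\<bar> \<le> \<bar>\<phi> x\<bar> * u k"
    using AE_decay[OF mem, of k] AE_space[of \<nu>]
  proof eventually_elim
    case (elim x)
    \<comment> \<open>Decay like \<open>\<theta> = \<rho> ^ 3\<close> is weakened to decay like
      \<open>\<rho>\<close>, so that covariances are measured by the same \<open>u\<close>.\<close>
    have "2 * M * \<kappa> * \<theta> ^ k * N \<phi> \<le> A * \<rho> ^ k * N \<phi>"
    proof (intro mult_right_mono mult_mono)
      have "\<theta> ^ k = (\<rho> ^ k) ^ 3" by (rule \<rho>_power_cubed[symmetric])
      also have "\<dots> \<le> \<rho> ^ k" using \<rho> power_decreasing[of 1 3 "\<rho> ^ k"] by (simp add: power_le_one)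
      finally show "\<theta> ^ k \<le> \<rho> ^ k" .
    qed (use A_ge N_nonneg \<theta> in auto)
    then have "\<bar>(P ^^ k) \<phi> x\<bar> \<le> u k"
      using elim abs_op_le[of x k] centered space_stat by (simp add: u_def)
    then show ?case unfolding abs_mult by (intro mult_left_mono) auto
  qed
qed

lemma AE_\<phi>: "AE x in \<nu>. \<bar>\<phi> x\<bar> \<le> 2 * M * N \<phi>"
  by (rule alg.AE_abs_le[OF mem])

section \<open>Expectations of four factors in terms of the gaps\<close>

definition T :: "nat \<Rightarrow> nat \<Rightarrow> nat \<Rightarrow> nat \<Rightarrow> real" where
  "T i a b c = (LINT \<omega>|\<Omega>. \<phi> (X i \<omega>) * \<phi> (X (i + a) \<omega>) * \<phi> (X (i + a + b) \<omega>) * \<phi> (X (i + a + b + c) \<omega>))"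

lemmas T_eq = integral_X_mult4[OF bounded, folded T_def]

text \<open>The function left at the third time once the last gap \<open>k\<close> is integrated
  out; since \<open>\<phi>\<close> is centred, its \<open>\<nu>\<close>-integral is the covariance
  at lag \<open>k\<close>.\<close>

abbreviation h :: "nat \<Rightarrow> 'b \<Rightarrow> real" where "h k \<equiv> \<lambda>x. \<phi> x * (P ^^ k) \<phi> x"

lemma h_mem: "h k \<in> B" and norm_h_le: "N (h k) \<le> 2 * M * G * N \<phi> ^ 2"
proof -
  show "h k \<in> B" by (intro alg.mult_mem op_pow_mem mem)
  have "N (h k) \<le> 2 * M * N \<phi> * N ((P ^^ k) \<phi>)" by (intro alg.norm_mult_le op_pow_mem mem)
  also have "\<dots> \<le> 2 * M * N \<phi> * (G * N \<phi>)"
    using alg.M_pos N_nonneg by (intro mult_left_mono norm_op_pow_le mem) auto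
  finally show "N (h k) \<le> 2 * M * G * N \<phi> ^ 2" by (simp add: power2_eq_square mult_ac)
qed

lemma h_bounded: "h k \<in> bounded_measurable E (m * m)"
  by (rule bounded_measurable_mult[OF bounded bounded_measurable_markov_operator[OF bounded]])

text \<open>The entry of the minimum that competes with the decaying bounds: one factor contributes
  \<open>\<delta>\<close>, the other three \<open>m\<close> each.\<close>

lemma T_le_trivial: "\<bar>T i a b c\<bar> \<le> \<delta> * m ^ 3"
  unfolding T_def
proof (rule abs_integral_X_le)
  show "AE \<omega> in \<Omega>. \<bar>\<phi> (X i \<omega>) * \<phi> (X (i + a) \<omega>) * \<phi> (X (i + a + b) \<omega>) * \<phi> (X (i + a + b + c) \<omega>)\<bar>
      \<le> \<bar>\<phi> (X i \<omega>)\<bar> * m ^ 3"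
  proof (rule AE_I2)
    fix \<omega> assume "\<omega> \<in> space \<Omega>"
    then have b: "\<bar>\<phi> (X k \<omega>)\<bar> \<le> m" for k by (intro \<phi>_le X_space)
    have "\<bar>\<phi> (X (i + a) \<omega>)\<bar> * (\<bar>\<phi> (X (i + a + b) \<omega>)\<bar> * \<bar>\<phi> (X (i + a + b + c) \<omega>)\<bar>) \<le> m * (m * m)"
      using m_nonneg by (intro mult_mono b) auto
    from mult_left_mono[OF this, of "\<bar>\<phi> (X i \<omega>)\<bar>"]
    show "\<bar>\<phi> (X i \<omega>) * \<phi> (X (i + a) \<omega>) * \<phi> (X (i + a + b) \<omega>) * \<phi> (X (i + a + b + c) \<omega>)\<bar>
      \<le> \<bar>\<phi> (X i \<omega>)\<bar> * m ^ 3"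
      by (simp add: abs_mult mult.assoc power3_eq_cube)
  qed
qed

text \<open>One constant for the three gap bounds: \<open>y\<close> is \<open>1\<close>,
  \<open>G\<close> or \<open>G\<^sup>2\<close> for the last, middle or first gap, each at most the
  square of \<open>1 + G\<close>.\<close>

lemma le_A:
  assumes "y \<le> 1 + 2 * G + G\<^sup>2"
  shows "(2 * M) ^ 3 * \<kappa> * y * \<theta> ^ k * N \<phi> ^ 3 \<le> A * \<theta> ^ k * N \<phi> ^ 3"
proof -
  have "(2 * M) ^ 3 * \<kappa> * y \<le> (2 * M) ^ 3 * \<kappa> * (1 + G)\<^sup>2"
    using assms alg.M_pos \<kappa>_pos
    by (intro mult_left_mono) (simp_all add: power2_eq_square algebra_simps)
  also have "\<dots> \<le> A" by (rule A_ge)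
  finally show ?thesis using \<theta> N_nonneg by (intro mult_right_mono) auto
qed

text \<open>Each gap gives a bound decaying in that gap, by applying the spectral gap to the operator power
  sitting there; only for the middle gap does a product of covariances have to be subtracted.\<close>

lemma T_le_last_gap: "\<bar>T i a b c\<bar> \<le> \<delta> * (A * \<theta> ^ c * N \<phi> ^ 3)"
proof -
  let ?D = "2 * M * N \<phi>"
  have "\<bar>T i a b c\<bar> \<le> \<delta> * (?D * ?D * (2 * M * \<kappa> * \<theta> ^ c * N \<phi>))"
    unfolding T_eq(1)
  proof (rule abs_integral_X_le)
    show "AE \<omega> in \<Omega>. \<bar>\<phi> (X i \<omega>) * \<phi> (X (i + a) \<omega>) * \<phi> (X (i + a + b) \<omega>) * (P ^^ c) \<phi> (X (i + a + b) \<omega>)\<bar>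
      \<le> \<bar>\<phi> (X i \<omega>)\<bar> * (?D * ?D * (2 * M * \<kappa> * \<theta> ^ c * N \<phi>))"
      using AE_X[OF AE_\<phi>, of "i + a"] AE_X[OF AE_\<phi>, of "i + a + b"]
        AE_X[OF AE_decay[OF mem, of c], of "i + a + b"]
    proof eventually_elim
      case (elim \<omega>)
      have "\<bar>\<phi> (X (i + a) \<omega>)\<bar> * \<bar>\<phi> (X (i + a + b) \<omega>)\<bar> * \<bar>(P ^^ c) \<phi> (X (i + a + b) \<omega>)\<bar>
          \<le> ?D * ?D * (2 * M * \<kappa> * \<theta> ^ c * N \<phi>)"
        using elim centered N_nonneg alg.M_pos by (intro mult_mono) auto
      from mult_left_mono[OF this, of "\<bar>\<phi> (X i \<omega>)\<bar>"] show ?case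
        by (simp add: abs_mult mult.assoc)
    qed
  qed
  also have "\<dots> = \<delta> * ((2 * M) ^ 3 * \<kappa> * 1 * \<theta> ^ c * N \<phi> ^ 3)"
    by (simp add: power3_eq_cube mult_ac)
  also have "\<dots> \<le> \<delta> * (A * \<theta> ^ c * N \<phi> ^ 3)"
    using \<delta>_nonneg G_nonneg by (intro mult_left_mono le_A) auto
  finally show ?thesis .
qed

lemma T_le_first_gap: "\<bar>T i a b c\<bar> \<le> \<delta> * (A * \<theta> ^ a * N \<phi> ^ 3)"
proof -
  let ?g = "\<lambda>x. \<phi> x * (P ^^ b) (h c) x" and ?D = "2 * M * N \<phi>"
  have gB: "?g \<in> B" by (intro alg.mult_mem op_pow_mem h_mem mem)
  \<comment> \<open>Two products cost \<open>2 * M\<close> each and two operator powers cost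
    \<open>G\<close> each.\<close>
  have "N ?g \<le> 2 * M * N \<phi> * N ((P ^^ b) (h c))"
    by (intro alg.norm_mult_le op_pow_mem h_mem mem)
  also have "\<dots> \<le> 2 * M * N \<phi> * (G * (2 * M * G * N \<phi> ^ 2))"
    using alg.M_pos N_nonneg G_nonneg
    by (intro mult_left_mono order_trans[OF norm_op_pow_le[OF h_mem]] norm_h_le) auto
  finally have Ng: "N ?g \<le> (2 * M)\<^sup>2 * G\<^sup>2 * N \<phi> ^ 3"
    by (simp add: power2_eq_square power3_eq_cube mult_ac)
  have gb: "?g \<in> bounded_measurable E (m * (m * m))"
    by (intro bounded_measurable_mult bounded bounded_measurable_markov_operator h_bounded)
  let ?e = "LINT x|\<nu>. ?g x"
  \<comment> \<open>Subtracting the mean \<open>?e\<close> changes nothing because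
    \<open>\<phi>\<close> is centred, and it makes the decay available at the first gap.\<close>
  have T: "T i a b c = (LINT x|\<nu>. \<phi> x * ((P ^^ a) ?g x - ?e))"
  proof -
    have "(LINT x|\<nu>. \<phi> x * ((P ^^ a) ?g x - ?e)) = (LINT x|\<nu>. \<phi> x * (P ^^ a) ?g x - ?e * \<phi> x)"
      by (simp add: algebra_simps)
    also have "\<dots> = (LINT x|\<nu>. \<phi> x * (P ^^ a) ?g x) - ?e * (LINT x|\<nu>. \<phi> x)"
      using integrable_stat[OF bounded]
        integrable_stat[OF bounded_measurable_mult[OF bounded bounded_measurable_markov_operator[OF gb]]]
      by simp
    finally show ?thesis using T_eq(3)[of i a b c] centered by simp
  qed
  have "\<bar>T i a b c\<bar> \<le> \<delta> * (2 * M * \<kappa> * \<theta> ^ a * N ?g)"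
    unfolding T
  proof (rule abs_integral_stat_le)
    show "AE x in \<nu>. \<bar>\<phi> x * ((P ^^ a) ?g x - ?e)\<bar> \<le> \<bar>\<phi> x\<bar> * (2 * M * \<kappa> * \<theta> ^ a * N ?g)"
      using AE_decay[OF gB, of a] by eventually_elim (unfold abs_mult, rule mult_left_mono, simp_all only: abs_ge_zero)
  qed
  also have "\<dots> \<le> \<delta> * (2 * M * \<kappa> * \<theta> ^ a * ((2 * M)\<^sup>2 * G\<^sup>2 * N \<phi> ^ 3))"
    using \<delta>_nonneg alg.M_pos \<kappa>_pos \<theta> by (intro mult_left_mono Ng) auto
  also have "\<dots> = \<delta> * ((2 * M) ^ 3 * \<kappa> * G\<^sup>2 * \<theta> ^ a * N \<phi> ^ 3)"
    by (simp add: power2_eq_square power3_eq_cube mult_ac)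
  also have "\<dots> \<le> \<delta> * (A * \<theta> ^ a * N \<phi> ^ 3)"
    using \<delta>_nonneg G_nonneg by (intro mult_left_mono le_A) auto
  finally show ?thesis .
qed

lemma T_le_middle_gap:
  "\<bar>T i a b c - (LINT x|\<nu>. h a x) * (LINT x|\<nu>. h c x)\<bar> \<le> \<delta> * (A * \<theta> ^ b * N \<phi> ^ 3)"
proof -
  let ?D = "2 * M * N \<phi>" and ?e = "LINT x|\<nu>. h c x"
  let ?Z = "\<lambda>\<omega>. \<phi> (X i \<omega>) * \<phi> (X (i + a) \<omega>)"
  let ?W = "\<lambda>\<omega>. (P ^^ b) (h c) (X (i + a) \<omega>)"
  have \<phi>m[measurable]: "\<phi> \<in> borel_measurable E" using bounded by (simp add: bounded_measurable_def)
  have Pm[measurable]: "(P ^^ b) (h c) \<in> borel_measurable E"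
    using bounded_measurable_markov_operator[OF h_bounded] by (simp add: bounded_measurable_def)
  have Zb: "\<bar>?Z \<omega>\<bar> \<le> m * m" and Wb: "\<bar>?W \<omega>\<bar> \<le> m * m" if "\<omega> \<in> space \<Omega>" for \<omega>
  proof -
    show "\<bar>?Z \<omega>\<bar> \<le> m * m"
      unfolding abs_mult using that m_nonneg by (intro mult_mono \<phi>_le X_space) auto
    show "\<bar>?W \<omega>\<bar> \<le> m * m"
      using bounded_measurable_markov_operator[OF h_bounded, of b c] X_space[OF that]
      by (simp add: bounded_measurable_def)
  qed
  have iZ: "integrable \<Omega> ?Z" by (rule integrable_real_bounded[of _ "m * m"]) (use Zb in auto)
  have iZW: "integrable \<Omega> (\<lambda>\<omega>. ?Z \<omega> * ?W \<omega>)"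
  proof (rule integrable_real_bounded[of _ "(m * m) * (m * m)"])
    fix \<omega> assume "\<omega> \<in> space \<Omega>"
    then show "\<bar>?Z \<omega> * ?W \<omega>\<bar> \<le> (m * m) * (m * m)"
      unfolding abs_mult[of "?Z \<omega>"] by (intro mult_mono Zb Wb) auto
  qed auto
  \<comment> \<open>The mean of the prefactor \<open>?Z\<close> is the covariance at lag
    \<open>a\<close> and need not vanish, so centring \<open>?W\<close> leaves a product of
    covariances.\<close>
  have "(LINT \<omega>|\<Omega>. ?Z \<omega> * (?W \<omega> - ?e)) = (LINT \<omega>|\<Omega>. ?Z \<omega> * ?W \<omega> - ?e * ?Z \<omega>)"
    by (simp add: algebra_simps)
  also have "\<dots> = (LINT \<omega>|\<Omega>. ?Z \<omega> * ?W \<omega>) - ?e * (LINT \<omega>|\<Omega>. ?Z \<omega>)"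
    using iZ iZW by simp
  also have "\<dots> = T i a b c - (LINT x|\<nu>. h a x) * ?e"
    using T_eq(2)[of i a b c] integral_X_mult[OF bounded bounded, of i a] by simp
  finally have eq: "T i a b c - (LINT x|\<nu>. h a x) * ?e = (LINT \<omega>|\<Omega>. ?Z \<omega> * (?W \<omega> - ?e))" ..
  have "\<bar>LINT \<omega>|\<Omega>. ?Z \<omega> * (?W \<omega> - ?e)\<bar> \<le> \<delta> * (?D * (2 * M * \<kappa> * \<theta> ^ b * N (h c)))"
  proof (rule abs_integral_X_le)
    show "AE \<omega> in \<Omega>. \<bar>?Z \<omega> * (?W \<omega> - ?e)\<bar> \<le> \<bar>\<phi> (X i \<omega>)\<bar> * (?D * (2 * M * \<kappa> * \<theta> ^ b * N (h c)))"
      using AE_X[OF AE_\<phi>, of "i + a"] AE_X[OF AE_decay[OF h_mem, of b c], of "i + a"]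
    proof eventually_elim
      case (elim \<omega>)
      have "\<bar>\<phi> (X (i + a) \<omega>)\<bar> * \<bar>?W \<omega> - ?e\<bar> \<le> ?D * (2 * M * \<kappa> * \<theta> ^ b * N (h c))"
        using elim N_nonneg alg.M_pos by (intro mult_mono) auto
      from mult_left_mono[OF this, of "\<bar>\<phi> (X i \<omega>)\<bar>"] show ?case
        by (simp add: abs_mult mult.assoc)
    qed
  qed
  also have "\<dots> \<le> \<delta> * (?D * (2 * M * \<kappa> * \<theta> ^ b * (2 * M * G * N \<phi> ^ 2)))"
    using \<delta>_nonneg alg.M_pos \<kappa>_pos \<theta> N_nonneg by (intro mult_left_mono norm_h_le) auto
  also have "\<dots> = \<delta> * ((2 * M) ^ 3 * \<kappa> * G * \<theta> ^ b * N \<phi> ^ 3)"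
    by (simp add: power2_eq_square power3_eq_cube mult_ac)
  also have "\<dots> \<le> \<delta> * (A * \<theta> ^ b * N \<phi> ^ 3)"
    using \<delta>_nonneg G_nonneg by (intro mult_left_mono le_A) auto
  finally show ?thesis unfolding eq .
qed

lemma abs_T_le: "\<bar>T i a b c\<bar> \<le> \<delta> * (u a * u b * u c) + \<delta>\<^sup>2 * (u a * u c)"
proof -
  \<comment> \<open>Since \<open>u\<close> is antimonotone, each of the three factors is at least
    \<open>u k\<close> when \<open>k\<close> is the largest gap.\<close>
  have max: "\<delta> * u k ^ 3 \<le> \<delta> * (u a * u b * u c)" if "a \<le> k" "b \<le> k" "c \<le> k" for k
    unfolding power3_eq_cube
    using that u_nonneg \<delta>_nonneg by (intro mult_left_mono mult_mono u_antimono) auto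
  have nn: "0 \<le> \<delta>\<^sup>2 * (u a * u c)" using u_nonneg by simp
  consider "a \<le> c" "b \<le> c" | "b \<le> a" "c \<le> a" | "a \<le> b" "c \<le> b" by linarith
  then show ?thesis
  proof cases
    case 1
    then show ?thesis using max[of c] le_u_cubed[OF T_le_trivial T_le_last_gap, of i a b c] nn by simp
  next
    case 2
    then show ?thesis using max[of a] le_u_cubed[OF T_le_trivial T_le_first_gap, of i a b c] nn by simp
  next
    case 3
    let ?p = "(LINT x|\<nu>. h a x) * (LINT x|\<nu>. h c x)"
    have p: "\<bar>?p\<bar> \<le> \<delta>\<^sup>2 * (u a * u c)"
    proof -
      have "\<bar>?p\<bar> \<le> (\<delta> * u a) * (\<delta> * u c)"
        unfolding abs_mult[of "integral\<^sup>L _ _"]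
        using \<delta>_nonneg u_nonneg by (intro mult_mono abs_covariance_le) auto
      then show ?thesis by (simp add: power2_eq_square mult_ac)
    qed
    \<comment> \<open>Subtracting a nonnegative number keeps the trivial bound, so both hypotheses
      of \<open>le_u_cubed\<close> hold for this difference.\<close>
    have "\<bar>T i a b c\<bar> - \<bar>?p\<bar> \<le> \<delta> * u b ^ 3"
      by (rule le_u_cubed) (use T_le_trivial[of i a b c] T_le_middle_gap[of i a b c] in linarith)+
    then show ?thesis using p max[of b] 3 by linarith
  qed
qed

end

section \<open>Summation over ordered quadruples of times\<close>

lemma sum_shift_le:
  fixes u :: "nat \<Rightarrow> real"
  assumes u: "\<And>k. 0 \<le> u k" and k: "1 \<le> k"
  shows "(\<Sum>l=1..n. if k \<le> l then u (l - k) else 0) \<le> (\<Sum>t<n. u t)"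
proof -
  have "(\<Sum>l=1..n. if k \<le> l then u (l - k) else 0) = (\<Sum>l=k..n. u (l - k))"
    using k by (intro sum.mono_neutral_cong_right) auto
  \<comment> \<open>The gaps \<open>l - k\<close> are distinct, and they lie below \<open>n\<close>
    because times start at 1.\<close>
  also have "\<dots> = (\<Sum>t\<in>(\<lambda>l. l - k) ` {k..n}. u t)"
    by (subst sum.reindex) (auto simp: inj_on_def)
  also have "\<dots> \<le> (\<Sum>t<n. u t)"
    using u k by (intro sum_mono2) auto
  finally show ?thesis .
qed

context centered_observable
begin

text \<open>For sorted times, summing over the latest time first, each gap contributes at most
  \<open>U\<close>: the chain of three gaps gives \<open>n * U ^ 3\<close>, the two separate gaps
  give the square of \<open>n * U\<close>.\<close>

lemma fourth_moment_le:
  "(LINT \<omega>|\<Omega>. (\<Sum>i=1..n. \<phi> (X i \<omega>)) ^ 4)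
    \<le> 24 * (real n * \<delta> * (\<Sum>k<n. u k) ^ 3 + (real n)\<^sup>2 * \<delta>\<^sup>2 * (\<Sum>k<n. u k)\<^sup>2)"
proof -
  let ?I = "{1..n}"
  define U where "U = (\<Sum>k<n. u k)"
  define w where "w i j k l \<omega> = \<phi> (X i \<omega>) * \<phi> (X j \<omega>) * \<phi> (X k \<omega>) * \<phi> (X l \<omega>)" for i j k l \<omega>
  define g where "g i j k l = \<bar>LINT \<omega>|\<Omega>. w i j k l \<omega>\<bar>" for i j k l
  define v where "v k l = (if k \<le> l then u (l - k) else 0)" for k l
  have v0: "0 \<le> v k l" for k l by (simp add: v_def u_nonneg)
  have U0: "0 \<le> U" by (simp add: U_def sum_nonneg u_nonneg)
  have vU: "(\<Sum>l\<in>?I. v k l) \<le> U" if "k \<in> ?I" for k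
    unfolding v_def U_def using that by (intro sum_shift_le u_nonneg) auto
  have w_int: "integrable \<Omega> (w i j k l)" for i j k l
  proof (rule integrable_real_bounded[of _ "m * m * m * m"])
    have [measurable]: "\<phi> \<in> borel_measurable E" using bounded by (simp add: bounded_measurable_def)
    show "w i j k l \<in> borel_measurable \<Omega>" unfolding w_def[abs_def] by measurable
    fix \<omega> assume "\<omega> \<in> space \<Omega>"
    then show "\<bar>w i j k l \<omega>\<bar> \<le> m * m * m * m"
      unfolding w_def abs_mult using m_nonneg by (intro mult_mono \<phi>_le X_space) auto
  qed
  have pow: "(\<Sum>i\<in>?I. x i) ^ 4 = (\<Sum>i\<in>?I. \<Sum>j\<in>?I. \<Sum>k\<in>?I. \<Sum>l\<in>?I. x i * x j * x k * x l)"
    for x :: "nat \<Rightarrow> real"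
    by (simp add: power4_eq_xxxx sum_distrib_left sum_distrib_right) (simp add: mult_ac)
  have "(LINT \<omega>|\<Omega>. (\<Sum>i=1..n. \<phi> (X i \<omega>)) ^ 4)
      = (\<Sum>i\<in>?I. \<Sum>j\<in>?I. \<Sum>k\<in>?I. \<Sum>l\<in>?I. LINT \<omega>|\<Omega>. w i j k l \<omega>)"
    unfolding pow w_def[symmetric]
    by (simp add: Bochner_Integration.integral_sum Bochner_Integration.integrable_sum w_int)
  also have "\<dots> \<le> (\<Sum>i\<in>?I. \<Sum>j\<in>?I. \<Sum>k\<in>?I. \<Sum>l\<in>?I. g i j k l)"
    unfolding g_def by (intro sum_mono abs_ge_self)
  also have "\<dots> \<le> 24 * (\<Sum>i\<in>?I. \<Sum>j\<in>?I. \<Sum>k\<in>?I. \<Sum>l\<in>?I. if i \<le> j \<and> j \<le> k \<and> k \<le> l then g i j k l else 0)"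
    by (rule sum4_le_sum_sorted) (simp_all add: g_def w_def mult_ac)
  \<comment> \<open>\<open>v\<close> vanishes on decreasing pairs, so the ordering condition is
    replaced by the factors and all quadruples may be summed.\<close>
  also have "\<dots> \<le> 24 * (\<Sum>i\<in>?I. \<Sum>j\<in>?I. \<Sum>k\<in>?I. \<Sum>l\<in>?I.
      \<delta> * (v i j * (v j k * v k l)) + \<delta>\<^sup>2 * (v i j * v k l))"
  proof (intro mult_left_mono sum_mono)
    fix i j k l
    show "(if i \<le> j \<and> j \<le> k \<and> k \<le> l then g i j k l else 0)
        \<le> \<delta> * (v i j * (v j k * v k l)) + \<delta>\<^sup>2 * (v i j * v k l)"
    proof (cases "i \<le> j \<and> j \<le> k \<and> k \<le> l")
      case True
      then have "g i j k l = \<bar>T i (j - i) (k - j) (l - k)\<bar>"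
        by (simp add: g_def w_def T_def)
      then show ?thesis using abs_T_le[of i "j - i" "k - j" "l - k"] True
        by (simp add: v_def mult.assoc)
    next
      case False
      then show ?thesis using v0 \<delta>_nonneg by (subst if_not_P) auto
    qed
  qed auto
  \<comment> \<open>The second term does not link \<open>j\<close> to \<open>k\<close>, so its
    quadruple sum factors.\<close>
  also have "(\<Sum>i\<in>?I. \<Sum>j\<in>?I. \<Sum>k\<in>?I. \<Sum>l\<in>?I.
        \<delta> * (v i j * (v j k * v k l)) + \<delta>\<^sup>2 * (v i j * v k l))
      = \<delta> * (\<Sum>i\<in>?I. \<Sum>j\<in>?I. v i j * (\<Sum>k\<in>?I. v j k * (\<Sum>l\<in>?I. v k l)))
        + \<delta>\<^sup>2 * ((\<Sum>i\<in>?I. \<Sum>j\<in>?I. v i j) * (\<Sum>k\<in>?I. \<Sum>l\<in>?I. v k l))"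
    unfolding sum.distrib sum_distrib_right[of _ _ "\<Sum>k\<in>?I. \<Sum>l\<in>?I. v k l"]
    by (simp only: sum_distrib_left)
  also have "\<dots> \<le> \<delta> * (\<Sum>i\<in>?I. U * (U * U)) + \<delta>\<^sup>2 * ((\<Sum>i\<in>?I. U) * (\<Sum>k\<in>?I. U))"
  proof -
    have s1: "(\<Sum>k\<in>?I. v j k * (\<Sum>l\<in>?I. v k l)) \<le> U * U" if "j \<in> ?I" for j
    proof -
      have "(\<Sum>k\<in>?I. v j k * (\<Sum>l\<in>?I. v k l)) \<le> (\<Sum>k\<in>?I. v j k * U)"
        by (intro sum_mono mult_left_mono vU v0)
      also have "\<dots> \<le> U * U"
        unfolding sum_distrib_right[symmetric] by (intro mult_right_mono vU that U0)
      finally show ?thesis .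
    qed
    have s2: "(\<Sum>j\<in>?I. v i j * (\<Sum>k\<in>?I. v j k * (\<Sum>l\<in>?I. v k l))) \<le> U * (U * U)" if "i \<in> ?I" for i
    proof -
      have "(\<Sum>j\<in>?I. v i j * (\<Sum>k\<in>?I. v j k * (\<Sum>l\<in>?I. v k l))) \<le> (\<Sum>j\<in>?I. v i j * (U * U))"
        by (intro sum_mono mult_left_mono s1 v0)
      also have "\<dots> \<le> U * (U * U)"
        unfolding sum_distrib_right[symmetric] using U0 by (intro mult_right_mono vU that) simp
      finally show ?thesis .
    qed
    have "(\<Sum>i\<in>?I. \<Sum>j\<in>?I. v i j * (\<Sum>k\<in>?I. v j k * (\<Sum>l\<in>?I. v k l))) \<le> (\<Sum>i\<in>?I. U * (U * U))"
      by (intro sum_mono s2)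
    moreover have "(\<Sum>i\<in>?I. \<Sum>j\<in>?I. v i j) * (\<Sum>k\<in>?I. \<Sum>l\<in>?I. v k l) \<le> (\<Sum>i\<in>?I. U) * (\<Sum>k\<in>?I. U)"
      using U0 by (intro mult_mono sum_mono vU sum_nonneg v0) auto
    ultimately show ?thesis
      using \<delta>_nonneg by (intro add_mono mult_left_mono) auto
  qed
  also have "\<dots> = real n * \<delta> * U ^ 3 + (real n)\<^sup>2 * \<delta>\<^sup>2 * U\<^sup>2"
    by (simp add: power3_eq_cube power2_eq_square mult_ac)
  finally show ?thesis unfolding U_def by simp
qed

end

section \<open>Choice of constants and the final estimate\<close>

theorem corollary2:
  fixes \<Omega> :: "'w measure" and E \<nu> :: "'e measure" and Q :: "'e \<Rightarrow> 'e measure"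
    and X :: "nat \<Rightarrow> 'w \<Rightarrow> 'e"
    and B :: "('e \<Rightarrow> real) set" and N :: "('e \<Rightarrow> real) \<Rightarrow> real"
    and p q :: ennreal and M :: real
  assumes chain: "markov_chain \<Omega> E Q X"
    and stationary: "stationary_distribution E Q \<nu>"
    and initial: "distr \<Omega> E (X 0) = \<nu>"
    and banach: "banach_function_space \<nu> B N"
    and one: "(\<lambda>x. 1) \<in> B"
    and acts: "\<forall>f\<in>B. markov_operator Q f \<in> B"
    and ergodic: "geometrically_ergodic Q \<nu> B N"
    and p: "p \<ge> 1" "continuously_included \<nu> B N p"
    and q: "q \<ge> 1" "1 / p + 1 / q = 1"
    and M: "M > 0"
    and mult: "\<forall>f\<in>B. \<forall>n. (\<lambda>x. f x * (markov_operator Q ^^ n) f x) \<in> B \<and>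
      N (\<lambda>x. f x * (markov_operator Q ^^ n) f x) \<le> M * N f * N ((markov_operator Q ^^ n) f)"
  shows "\<exists>K::real. \<forall>\<phi>\<in>B. \<forall>n\<ge>1.
    bdd_above ((\<lambda>x. \<bar>\<phi> x\<bar>) ` space E) \<longrightarrow> (LINT x|\<nu>. \<phi> x) = 0 \<longrightarrow>
    (let m = max 1 (SUP x\<in>space E. \<bar>\<phi> x\<bar>) in
      (LINT \<omega>|\<Omega>. (\<Sum>i=1..n. \<phi> (X i \<omega>)) ^ 4)
        \<le> K * m ^ 3 * (real n * Lp_norm \<nu> q \<phi> * (ln (N \<phi> + 1)) ^ 3
            + (real n)\<^sup>2 * (Lp_norm \<nu> q \<phi>)\<^sup>2 * (ln (N \<phi> + 1))\<^sup>2))"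
proof -
  interpret banach_function_space \<nu> B N by (rule banach)
  interpret stationary_markov_chain \<Omega> E Q X \<nu>
    by unfold_locales (fact chain stationary initial)+
  obtain \<kappa> \<theta> where \<kappa>: "0 < \<kappa>" and \<theta>: "0 < \<theta>" "\<theta> < 1"
    and decay: "\<And>f n. f \<in> B \<Longrightarrow>
      N (\<lambda>x. (markov_operator Q ^^ n) f x - (LINT y|\<nu>. f y)) \<le> \<kappa> * \<theta> ^ n * N f"
    using ergodic by (auto simp: geometrically_ergodic_def)
  obtain C where C: "0 < C" and BL: "B \<subseteq> Lp_space \<nu> p"
    and Lp: "\<And>f. f \<in> B \<Longrightarrow> Lp_norm \<nu> p f \<le> C * N f"
    using p(2) by (auto simp: continuously_included_def)
  \<comment> \<open>The embedding constant is \<open>2 * C\<close> because of the factor 2 in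
    \<open>L1_le_Lp_norm\<close>.\<close>
  interpret ergodic_chain \<Omega> E Q X \<nu> B N M "2 * C" \<kappa> \<theta>
  proof
    fix f assume f: "f \<in> B"
    then have fL: "f \<in> Lp_space \<nu> p" using BL by auto
    show "integrable \<nu> f" by (rule stat.L1_le_Lp_norm(1)[OF p(1) fL])
    show "(LINT x|\<nu>. \<bar>f x\<bar>) \<le> 2 * C * N f"
      using stat.L1_le_Lp_norm(2)[OF p(1) fL] Lp[OF f] by simp
    show "(\<lambda>x. f x * f x) \<in> B" "N (\<lambda>x. f x * f x) \<le> M * N f * N f"
      using mult[rule_format, OF f, of 0] by simp_all
  qed (use M C \<kappa> \<theta> one acts decay in auto)
  \<comment> \<open>The constant of \<open>sum_min_geometric_le\<close> for \<open>A\<close> and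
    \<open>\<rho>\<close>, so that the sum of the \<open>u k\<close> is at most
    \<open>K * m * L\<close>.\<close>
  define K where "K = 2 * (A + 1) / (1 - \<rho>)"
  have K0: "0 \<le> K" using A_ge(1) \<rho> by (simp add: K_def)
  show ?thesis
  \<comment> \<open>24 counts the orderings of four times; 2 and 4 come from
    \<open>\<delta> \<le> 2 * s\<close> and its square. Adding the coefficients gives one constant
    for both terms.\<close>
  proof (intro exI[of _ "24 * (2 * K ^ 3 + 4 * K\<^sup>2)"] ballI allI impI)
    fix \<phi> n
    assume \<phi>: "\<phi> \<in> B" and bdd: "bdd_above ((\<lambda>x. \<bar>\<phi> x\<bar>) ` space E)" and zero: "(LINT x|\<nu>. \<phi> x) = 0"
    define m where "m = max 1 (SUP x\<in>space E. \<bar>\<phi> x\<bar>)"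
    have m1: "1 \<le> m" by (simp add: m_def)
    have \<phi>m: "\<phi> \<in> bounded_measurable E m"
    proof -
      have "\<phi> \<in> borel_measurable E"
        using \<phi> measurable by (auto simp: measurable_cong_sets[OF sets_stat refl])
      moreover have "\<bar>\<phi> x\<bar> \<le> m" if "x \<in> space E" for x
        using cSUP_upper[OF that bdd] by (simp add: m_def)
      ultimately show ?thesis by (simp add: bounded_measurable_def)
    qed
    interpret centered_observable \<Omega> E Q X \<nu> B N M "2 * C" \<kappa> \<theta> \<phi> m
      by unfold_locales (fact \<phi> \<phi>m zero)+
    define L where "L = ln (N \<phi> + 1)"
    define U where "U = (\<Sum>k<n. u k)"
    define s where "s = Lp_norm \<nu> q \<phi>"
    have L0: "0 \<le> L" using N_nonneg by (simp add: L_def)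
    have U0: "0 \<le> U" by (simp add: U_def sum_nonneg u_nonneg)
    have UL: "U \<le> K * m * L"
      unfolding U_def u_def K_def L_def
      using \<rho> A_ge(1) N_nonneg m1 by (intro sum_min_geometric_le) auto
    have "\<phi> \<in> Lp_space \<nu> q"
      using \<phi> measurable \<phi>_le by (intro stat.bounded_in_Lp_space[of _ m]) (auto simp: space_stat)
    then have \<delta>s: "\<delta> \<le> 2 * s"
      unfolding \<delta>_def s_def by (rule stat.L1_le_Lp_norm(2)[OF q(1)])
    have s0: "0 \<le> s" using \<delta>s \<delta>_nonneg by linarith
    have U3: "U ^ 3 \<le> K ^ 3 * m ^ 3 * L ^ 3"
      using power_mono[OF UL U0, of 3] by (simp add: power_mult_distrib)
    \<comment> \<open>\<open>m \<ge> 1\<close> raises the square to a cube, so that both terms share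
      the factor \<open>m ^ 3\<close>.\<close>
    have U2: "U\<^sup>2 \<le> K\<^sup>2 * m ^ 3 * L\<^sup>2"
    proof -
      have "U\<^sup>2 \<le> K\<^sup>2 * m\<^sup>2 * L\<^sup>2"
        using power_mono[OF UL U0, of 2] by (simp add: power_mult_distrib)
      also have "\<dots> \<le> K\<^sup>2 * m ^ 3 * L\<^sup>2"
        using m1 by (intro mult_right_mono mult_left_mono power_increasing) auto
      finally show ?thesis .
    qed
    have "(LINT \<omega>|\<Omega>. (\<Sum>i=1..n. \<phi> (X i \<omega>)) ^ 4)
        \<le> 24 * (real n * \<delta> * U ^ 3 + (real n)\<^sup>2 * \<delta>\<^sup>2 * U\<^sup>2)"
      unfolding U_def by (rule fourth_moment_le)
    also have "\<dots> \<le> 24 * (real n * (2 * s) * (K ^ 3 * m ^ 3 * L ^ 3)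
        + (real n)\<^sup>2 * (2 * s)\<^sup>2 * (K\<^sup>2 * m ^ 3 * L\<^sup>2))"
      using \<delta>s \<delta>_nonneg s0 U0
      by (intro mult_left_mono add_mono mult_mono power_mono U3 U2) auto
    also have "\<dots> = 24 * m ^ 3 * (2 * K ^ 3 * (real n * s * L ^ 3) + 4 * K\<^sup>2 * ((real n)\<^sup>2 * s\<^sup>2 * L\<^sup>2))"
      by (simp add: power_mult_distrib algebra_simps)
    also have "\<dots> \<le> 24 * m ^ 3 * ((2 * K ^ 3 + 4 * K\<^sup>2) * (real n * s * L ^ 3)
        + (2 * K ^ 3 + 4 * K\<^sup>2) * ((real n)\<^sup>2 * s\<^sup>2 * L\<^sup>2))"
      using m1 K0 s0 L0 by (intro mult_left_mono add_mono mult_right_mono) auto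
    finally have "(LINT \<omega>|\<Omega>. (\<Sum>i=1..n. \<phi> (X i \<omega>)) ^ 4)
        \<le> 24 * (2 * K ^ 3 + 4 * K\<^sup>2) * m ^ 3 * (real n * s * L ^ 3 + (real n)\<^sup>2 * s\<^sup>2 * L\<^sup>2)"
      by (simp add: algebra_simps)
    then show "let m = max 1 (SUP x\<in>space E. \<bar>\<phi> x\<bar>) in
      (LINT \<omega>|\<Omega>. (\<Sum>i=1..n. \<phi> (X i \<omega>)) ^ 4)
        \<le> 24 * (2 * K ^ 3 + 4 * K\<^sup>2) * m ^ 3 * (real n * Lp_norm \<nu> q \<phi> * (ln (N \<phi> + 1)) ^ 3
            + (real n)\<^sup>2 * (Lp_norm \<nu> q \<phi>)\<^sup>2 * (ln (N \<phi> + 1))\<^sup>2)"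
      unfolding Let_def m_def[symmetric] s_def[symmetric] L_def[symmetric] .
  qed
qed

end
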